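(* Let $\{(i_t,j_t)\}_{t\in\mathbb{N}}$ be a sequence with $i_t,j_t\in[0,1]$ and $i_t+j_t=1$ for every $t$. Let $i=\sup_{t\in\mathbb{N}}i_t$, let $\theta\in\mathbf{Bad}(i)$, and let $\Theta=\{(\theta,y):y\in[0,1]\}$. Let $\mathbf{C}\subseteq\Theta$ be the support of a (nonzero) measure satisfying a power law. Then $$\mathbf{C}\cap\bigcap_{t\in\mathbb{N}}\mathbf{Bad}(i_t,j_t)\neq\varnothing.$$
   Context: $\mathbf{Bad}(i,j)$, for $i,j\in[0,1]$ with $i+j=1$: for $i,j>0$, $$\mathbf{Bad}(i,j)=\left\{(x,y)\in\mathbb{R}^2:\exists c>0\ \forall p_1,p_2\in\mathbb{Z},\ q\in\mathbb{N},\ \ \max\left\{q|qx-p_1|^{1/i},\,q|qy-p_2|^{1/j}\right\}>c\right\},$$ while $\mathbf{Bad}(1,0)=\mathbf{BA}\times\mathbb{R}$ and $\mathbf{Bad}(0,1)=\mathbb{R}\times\mathbf{BA}$, where $\mathbf{BA}$ is the classical set of badly approximable real numbers, $\{x\in\mathbb{R}:\exists c>0\ \forall p\in\mathbb{Z},q\in\mathbb{N}:\ q|qx-p|>c\}$. $\mathbf{Bad}(i)$: for $i>0$, $\mathbf{Bad}(i)=\{x\in\mathbb{R}:\exists c>0\ \forall p\in\mathbb{Z},q\in\mathbb{N}:\ q^{1/i}|qx-p|>c\}$, and $\mathbf{Bad}(0)=\mathbb{R}$. Here $\mathbb{N}=\{1,2,\dots\}$. Power law: a Borel measure $\mu$ on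 a metric space satisfies a power law if there are positive $\beta,b_1,b_2$ such that $b_1r^\beta\le\mu(B(x,r))\le b_2r^\beta$ for all $x\in\mathrm{supp}(\mu)$ and $0<r<1$. *)

theory Defs
  imports "HOL-Analysis.Analysis"
begin

definition BA :: "real set" where
  "BA = {x. \<exists>c>0. \<forall>(p::int) (q::nat). q \<ge> 1 \<longrightarrow>
              real q * \<bar>real q * x - of_int p\<bar> > c}"

text \<open>The following sets are meant for weights with \<open>i, j \<in> [0,1]\<close> and \<open>i + j = 1\<close>; the first
  two branches are then the pairs \<open>(1,0)\<close> and \<open>(0,1)\<close>.\<close>

definition Bad :: "real \<Rightarrow> real \<Rightarrow> (real \<times> real) set" where
  "Bad i j =
     (if j = 0 then BA \<times> UNIV
      else if i = 0 then UNIV \<times> BA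
      else {(x, y). \<exists>c>0. \<forall>(p1::int) (p2::int) (q::nat). q \<ge> 1 \<longrightarrow>
              max (real q * \<bar>real q * x - of_int p1\<bar> powr (1 / i))
                  (real q * \<bar>real q * y - of_int p2\<bar> powr (1 / j)) > c})"

definition Bad1 :: "real \<Rightarrow> real set" where
  "Bad1 i =
     (if i = 0 then UNIV
      else {x. \<exists>c>0. \<forall>(p::int) (q::nat). q \<ge> 1 \<longrightarrow>
              real q powr (1 / i) * \<bar>real q * x - of_int p\<bar> > c})"

definition measure_support :: "'a::topological_space measure \<Rightarrow> 'a set" where
  "measure_support M = {x. \<forall>U. open U \<and> x \<in> U \<longrightarrow> emeasure M U > 0}"

text \<open>Replacing open balls by closed balls gives the same condition with the same constants,
  by continuity of the measure along increasing and decreasing families of balls.\<close>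

definition power_law :: "'a::metric_space measure \<Rightarrow> bool" where
  "power_law M \<longleftrightarrow>
     (\<exists>\<beta>>0. \<exists>b1>0. \<exists>b2>0. \<forall>x\<in>measure_support M. \<forall>r. 0 < r \<and> r < 1 \<longrightarrow>
        ennreal (b1 * r powr \<beta>) \<le> emeasure M (ball x r) \<and>
        emeasure M (ball x r) \<le> ennreal (b2 * r powr \<beta>))"

end

theory Submission
  imports Defs
begin

text \<open>
All points of \<open>C\<close> have abscissa \<open>\<theta>\<close>, so only the ordinate \<open>y\<close> has to be found. Fix a pair
\<open>(i, j)\<close> of positive weights. For a small constant \<open>\<epsilon>\<close> the number \<open>y\<close> has to avoid, for
every rational point \<open>(p / q, r / q)\<close> with \<open>\<bar>q \<theta> - p\<bar> < \<epsilon> q\<^sup>-\<^sup>i\<close>, the interval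
\<open>\<bar>q y - r\<bar> < \<epsilon> q\<^sup>-\<^sup>j\<close>. Through such a point there is a rational line \<open>A x + B y + C = 0\<close>
with \<open>\<bar>A\<bar> \<le> q\<^sup>i\<close> and \<open>\<bar>B\<bar> \<le> q\<^sup>j\<close>, by the pigeonhole principle, and \<open>\<theta> \<in> Bad(i)\<close> excludes
that it is vertical. The line meets the fibre over \<open>\<theta>\<close> in a point at distance at most
\<open>2 \<epsilon> / (q B)\<close> from every \<open>y\<close> in the interval. So the obstacles are sorted by their height
\<open>q B\<close>, in powers of a large number \<open>R\<close>, and all forbidden intervals of height \<open>R ^ n\<close> that
belong to the same line lie in a single interval of length of order \<open>\<epsilon> / R ^ n\<close>.

There are too many lines of a given height for a direct count. The obstacles of height
\<open>R ^ n\<close> are therefore subdivided into classes according to the size of \<open>q\<^sup>j / B\<close>, and the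
decisive fact is \<open>obstacle_pair\<close>: an interval of length of order \<open>\<epsilon> R ^ (c + 1) / R ^ n\<close>
that has escaped the obstacles of height less than \<open>R ^ (n - c - 1)\<close> meets the class \<open>c\<close>
of height \<open>R ^ n\<close> in a set of diameter of order \<open>\<epsilon> / R ^ n\<close> only. For \<open>c > 0\<close> the reason
is that two different lines of this class would intersect in a rational point of much
smaller denominator. This point is so close to \<open>(\<theta>, y)\<close> that it forbids \<open>y\<close> as well, at a
height that has been dealt with (\<open>intersection_is_dangerous\<close>). For \<open>c = 0\<close> the
denominators are comparable and a determinant that is an integer of absolute value less
than \<open>1\<close> shows that each of the two points lies on both lines (\<open>obstacle_pair_class_0\<close>).

The rest is a potential argument. The power law provides a ratio \<open>r\<close> such that every ball
of radius \<open>r ^ m\<close> centred in \<open>C\<close> contains four well separated balls of radius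
\<open>r ^ (m + 1)\<close> with the same property (\<open>power_law_branching\<close>). Every obstacle is given a
weight that decreases exponentially with its size exponent, and one keeps choosing a child
ball of small total weight (\<open>avoid_finitely_many_obstacles\<close>). By the diameter property,
the class \<open>c\<close> of height \<open>R ^ n\<close> counts as one small obstacle from \<open>c + 1\<close> levels of the
\<open>R\<close>-scale before its own size, so the weights that have to be added at one stage form a
geometric series in \<open>c\<close>. All pairs of weights are treated at once by letting the \<open>t\<close>-th
pair have \<open>R = r\<^sup>-\<^sup>(\<^sup>t\<^sup>+\<^sup>5\<^sup>)\<close>, so that the series also converges over \<open>t\<close>
(\<open>avoid_obstacle_families\<close>). Nothing has to be uniform in \<open>t\<close>: the constants \<open>\<epsilon>\<close> only
affect the scale at which the \<open>t\<close>-th family enters.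
\<close>

section \<open>Separated points in the support of a measure with a power law\<close>

lemma closed_measure_support: "closed (measure_support M)"
proof -
  have "open (- measure_support M)"
  proof (subst open_subopen, intro ballI)
    fix x assume "x \<in> - measure_support M"
    then obtain U where U: "open U" "x \<in> U" "\<not> emeasure M U > 0"
      by (auto simp: measure_support_def)
    then have "U \<subseteq> - measure_support M"
      by (auto simp: measure_support_def)
    with U show "\<exists>T. open T \<and> x \<in> T \<and> T \<subseteq> - measure_support M" by blast
  qed
  then show ?thesis by (simp add: closed_def)
qed

text \<open>
The complement of the support is a union of open null sets, and second countability
reduces that union to a countable one.
\<close>

lemma null_set_outside_measure_support:
  fixes M :: "'a::second_countable_topology measure"
  assumes "sets M = sets borel"
  shows "- measure_support M \<in> null_sets M"
proof -
  let ?\<U> = "{U. open U \<and> emeasure M U = 0}"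
  have union: "\<Union>?\<U> = - measure_support M"
    by (auto simp: measure_support_def zero_less_iff_neq_zero)
  obtain \<V> where \<V>: "\<V> \<subseteq> ?\<U>" "countable \<V>" "\<Union>\<V> = \<Union>?\<U>"
    using Lindelof[of ?\<U>] by auto
  have "\<And>U. U \<in> \<V> \<Longrightarrow> U \<in> null_sets M"
    using \<V>(1) assms by (auto simp: null_sets_def)
  then have "\<Union>\<V> \<in> null_sets M"
    using \<V>(2) null_sets_UN'[of \<V> "\<lambda>U. U" M] by simp
  with \<V>(3) union show ?thesis by simp
qed

text \<open>
Points are chosen greedily: as long as at most \<open>N\<close> have been chosen, the balls of radius
\<open>s\<close> around them do not have enough mass to exhaust the big ball, and what is left has
positive mass, so it contains a further point of the support.
\<close>

lemma separated_points_in_ball: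
  fixes M :: "'a::{metric_space, second_countable_topology} measure"
  assumes M: "sets M = sets borel"
    and x: "x \<in> measure_support M"
    and s: "0 < s"
    and small: "\<And>y. y \<in> measure_support M \<Longrightarrow> of_nat N * emeasure M (ball y s) < emeasure M (ball x \<rho>)"
  shows "n \<le> Suc N \<Longrightarrow> \<exists>F. F \<subseteq> measure_support M \<inter> ball x \<rho> \<and> finite F \<and> card F = n \<and>
           pairwise (\<lambda>y z. s \<le> dist y z) F"
proof (induction n)
  case 0
  show ?case by (rule exI[of _ "{}"]) auto
next
  case (Suc n)
  then obtain F where F: "F \<subseteq> measure_support M \<inter> ball x \<rho>" "finite F" "card F = n"
    "pairwise (\<lambda>y z. s \<le> dist y z) F" by auto
  have "\<exists>z \<in> measure_support M \<inter> ball x \<rho>. \<forall>y\<in>F. s \<le> dist y z"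
  proof (rule ccontr)
    assume "\<not> ?thesis"
    then have sub: "ball x \<rho> \<subseteq> (\<Union>y\<in>F. ball y s) \<union> - measure_support M"
      by (auto simp: not_le)
    have N: "- measure_support M \<in> null_sets M"
      using M by (rule null_set_outside_measure_support)
    have "open (\<Union>y\<in>F. ball y s)" by blast
    then have balls: "(\<Union>y\<in>F. ball y s) \<in> sets M" unfolding M by (rule borel_open)
    have "emeasure M (ball x \<rho>) \<le> emeasure M ((\<Union>y\<in>F. ball y s) \<union> - measure_support M)"
      by (rule emeasure_mono[OF sub sets.Un[OF balls null_setsD2[OF N]]])
    also have "\<dots> = emeasure M (\<Union>y\<in>F. ball y s)"
      by (rule emeasure_Un_null_set[OF balls N])
    also have "\<dots> \<le> (\<Sum>y\<in>F. emeasure M (ball y s))"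
      using M F by (intro emeasure_subadditive_finite) auto
    finally have le: "emeasure M (ball x \<rho>) \<le> (\<Sum>y\<in>F. emeasure M (ball y s))" .
    show False
    proof (cases "F = {}")
      case True
      with le small[OF x] show False by auto
    next
      case False
      define b where "b = Max ((\<lambda>y. emeasure M (ball y s)) ` F)"
      have "b \<in> (\<lambda>y. emeasure M (ball y s)) ` F"
        unfolding b_def using F False by (intro Max_in) auto
      then obtain y where y: "y \<in> F" "b = emeasure M (ball y s)" by auto
      have "(\<Sum>y\<in>F. emeasure M (ball y s)) \<le> of_nat (card F) * b"
        unfolding b_def using F by (intro sum_bounded_above) auto
      also have "\<dots> \<le> of_nat N * b"
        using F Suc.prems by (intro mult_right_mono) auto
      also have "\<dots> < emeasure M (ball x \<rho>)"
        unfolding y(2) using y(1) F by (intro small) auto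
      finally show False using le by simp
    qed
  qed
  then obtain z where z: "z \<in> measure_support M \<inter> ball x \<rho>" "\<forall>y\<in>F. s \<le> dist y z" by blast
  have "z \<notin> F" using z(2) s by force
  then have "finite (insert z F)" "card (insert z F) = Suc n" using F by auto
  moreover have "pairwise (\<lambda>y z. s \<le> dist y z) (insert z F)"
    using F(4) z(2) by (auto simp: pairwise_insert dist_commute)
  ultimately show ?case using F(1) z(1) by (intro exI[of _ "insert z F"]) auto
qed

text \<open>
The mass of a ball is proportional to \<open>\<rho>\<^sup>\<beta>\<close>, so for a small enough ratio \<open>r\<close> three balls of
radius \<open>3 r \<rho>\<close> cannot cover a ball of radius \<open>\<rho> / 2\<close> around a point of the support. This
is the only use of the power law: the support carries a tree of balls in which every ball
has four well separated children. Four is what the potential argument below needs.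
\<close>

lemma power_law_branching:
  fixes M :: "'a::{metric_space, second_countable_topology} measure"
  assumes M: "sets M = sets borel" and "power_law M"
  obtains r :: real where "0 < r" "r \<le> 1/8"
    "\<And>m x. x \<in> measure_support M \<Longrightarrow> \<exists>F. F \<subseteq> measure_support M \<and> finite F \<and> card F = 4 \<and>
       (\<forall>f\<in>F. ball f (r ^ Suc m) \<subseteq> ball x (r ^ m)) \<and> pairwise (\<lambda>y z. 3 * r ^ Suc m \<le> dist y z) F"
proof -
  obtain \<beta> b1 b2 where b: "\<beta> > 0" "b1 > 0" "b2 > 0" and
    law: "\<And>x r. x \<in> measure_support M \<Longrightarrow> 0 < r \<Longrightarrow> r < 1 \<Longrightarrow>
        ennreal (b1 * r powr \<beta>) \<le> emeasure M (ball x r) \<and>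
        emeasure M (ball x r) \<le> ennreal (b2 * r powr \<beta>)"
    using assms(2) unfolding power_law_def by blast
  \<comment> \<open>The choice makes \<open>3 b2 (3 r \<rho>)\<^sup>\<beta> < b1 (\<rho> / 2)\<^sup>\<beta>\<close> for every radius \<open>\<rho>\<close>.\<close>
  define v where "v = (b1 / (4 * b2)) powr (1 / \<beta>) / 6"
  define r where "r = min (1/8) v"
  have v: "v > 0" using b by (simp add: v_def)
  then have r: "0 < r" "r \<le> 1/8" "r \<le> v" by (auto simp: r_def)
  have "(6 * r) powr \<beta> \<le> (6 * v) powr \<beta>" using r b by (intro powr_mono2) auto
  also have "(6 * v) powr \<beta> = b1 / (4 * b2)" using b by (simp add: v_def powr_powr)
  finally have r6: "3 * b2 * (6 * r) powr \<beta> < b1" using b by (simp add: field_simps)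
  have main: "\<exists>F. F \<subseteq> measure_support M \<and> finite F \<and> card F = 4 \<and>
       (\<forall>f\<in>F. ball f (r ^ Suc m) \<subseteq> ball x (r ^ m)) \<and> pairwise (\<lambda>y z. 3 * r ^ Suc m \<le> dist y z) F"
    if x: "x \<in> measure_support M" for m x
  proof -
    define \<rho> where "\<rho> = r ^ m"
    have \<rho>: "0 < \<rho>" "\<rho> \<le> 1" using r by (auto simp: \<rho>_def power_le_one)
    have r\<rho>: "r * \<rho> \<le> \<rho> / 8" using r \<rho> by simp
    have small: "of_nat 3 * emeasure M (ball y (3 * r * \<rho>)) < emeasure M (ball x (\<rho> / 2))"
      if y: "y \<in> measure_support M" for y
    proof -
      have "of_nat 3 * emeasure M (ball y (3 * r * \<rho>)) \<le> of_nat 3 * ennreal (b2 * (3 * r * \<rho>) powr \<beta>)"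
        using law[OF y, of "3 * r * \<rho>"] r \<rho> r\<rho> by (intro mult_left_mono) auto
      also have "\<dots> = ennreal (3 * b2 * (6 * r) powr \<beta> * (\<rho> / 2) powr \<beta>)"
      proof -
        have "3 * r * \<rho> = (6 * r) * (\<rho> / 2)" by simp
        then have "(3 * r * \<rho>) powr \<beta> = ((6 * r) * (\<rho> / 2)) powr \<beta>" by (simp only:)
        also have "\<dots> = (6 * r) powr \<beta> * (\<rho> / 2) powr \<beta>" using r \<rho> by (intro powr_mult)
        finally have eq: "(3 * r * \<rho>) powr \<beta> = (6 * r) powr \<beta> * (\<rho> / 2) powr \<beta>" .
        have "of_nat 3 * ennreal (b2 * (3 * r * \<rho>) powr \<beta>) = ennreal 3 * ennreal (b2 * (3 * r * \<rho>) powr \<beta>)"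
          by simp
        also have "\<dots> = ennreal (3 * (b2 * (3 * r * \<rho>) powr \<beta>))"
          using b by (intro ennreal_mult[symmetric]) auto
        finally show ?thesis unfolding eq by (simp add: mult.assoc)
      qed
      also have "\<dots> < ennreal (b1 * (\<rho> / 2) powr \<beta>)"
        using r6 \<rho> b by (subst ennreal_less_iff) auto
      also have "\<dots> \<le> emeasure M (ball x (\<rho> / 2))"
        using law[OF x, of "\<rho> / 2"] \<rho> by auto
      finally show ?thesis .
    qed
    obtain F where F: "F \<subseteq> measure_support M \<inter> ball x (\<rho> / 2)" "finite F" "card F = 4"
      "pairwise (\<lambda>y z. 3 * r * \<rho> \<le> dist y z) F"
      using separated_points_in_ball[OF M x _ small, of 4] r \<rho> by auto
    have "ball f (r ^ Suc m) \<subseteq> ball x (r ^ m)" if "f \<in> F" for f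
    proof
      fix z assume "z \<in> ball f (r ^ Suc m)"
      then have "dist f z < r * \<rho>" by (simp add: \<rho>_def)
      moreover have "dist x f < \<rho> / 2" using F(1) that by auto
      ultimately have "dist x z < \<rho>"
        using dist_triangle[of x z f] r\<rho> \<rho> by linarith
      then show "z \<in> ball x (r ^ m)" by (simp add: \<rho>_def)
    qed
    moreover have "3 * r * \<rho> = 3 * r ^ Suc m" by (simp add: \<rho>_def)
    then have "pairwise (\<lambda>y z. 3 * r ^ Suc m \<le> dist y z) F" using F(4) by (simp only:)
    ultimately show ?thesis using F(1-3) by blast
  qed
  from r(1,2) main show ?thesis by (rule that)
qed

section \<open>The potential argument\<close>

text \<open>
An obstacle \<open>g\<close> becomes visible at stage \<open>s g\<close>: inside a ball of radius \<open>r ^ s g\<close> that has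
escaped all obstacles of size at least that radius, it is a set of diameter at most
\<open>r ^ e g\<close>. A descending sequence of balls is chosen such that the total weight
\<open>(1/2) ^ e g\<close> of the visible obstacles that meet the ball of radius \<open>r ^ m\<close> is at most
\<open>(1/2) ^ m / 4\<close>. No obstacle with \<open>e g \<le> m + 1\<close> can then meet that ball, since its weight
alone would be too large. Hence every obstacle that does meet it is so small that it meets
at most one of the four children, so some child inherits at most a quarter of the weight.
That is half of what the next stage allows, and the other half is left for the obstacles
that become visible there.
\<close>

lemma avoid_finitely_many_obstacles:
  fixes C :: "'a::metric_space set" and D :: "'g \<Rightarrow> 'a set" and s e :: "'g \<Rightarrow> nat"
  assumes r: "0 < r" "r \<le> 1"
    and C: "C \<noteq> {}"
    and branching: "\<And>m x. x \<in> C \<Longrightarrow> \<exists>F. F \<subseteq> C \<and> finite F \<and> card F = 4 \<and>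
       (\<forall>f\<in>F. ball f (r ^ Suc m) \<subseteq> ball x (r ^ m)) \<and> pairwise (\<lambda>y z. 3 * r ^ Suc m \<le> dist y z) F"
    and G: "finite G" and se: "\<And>g. g \<in> G \<Longrightarrow> s g < e g"
    and weight: "\<And>m. (\<Sum>g | g \<in> G \<and> s g = m. (1/2::real) ^ e g) \<le> (1/2) ^ m / 8"
    and small: "\<And>x g y z. x \<in> C \<Longrightarrow> g \<in> G \<Longrightarrow> 
        (\<And>h. h \<in> G \<Longrightarrow> e h \<le> s g \<Longrightarrow> C \<inter> ball x (r ^ s g) \<inter> D h = {}) \<Longrightarrow>
        y \<in> C \<inter> ball x (r ^ s g) \<inter> D g \<Longrightarrow> z \<in> C \<inter> ball x (r ^ s g) \<inter> D g \<Longrightarrow> dist y z \<le> r ^ e g"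
  shows "\<exists>x\<in>C. \<forall>g\<in>G. x \<notin> D g"
proof -
  define A where "A m x = {g \<in> G. s g \<le> m \<and> C \<inter> ball x (r ^ m) \<inter> D g \<noteq> {}}" for m x
  define \<phi> where "\<phi> m x = (\<Sum>g\<in>A m x. (1/2::real) ^ e g)" for m x
  define thin where "thin m x \<longleftrightarrow> (\<forall>g\<in>G. s g \<le> m \<longrightarrow>
     (\<forall>y z. y \<in> C \<inter> ball x (r ^ m) \<inter> D g \<longrightarrow> z \<in> C \<inter> ball x (r ^ m) \<inter> D g \<longrightarrow> dist y z \<le> r ^ e g))"
    for m x
  have finA [simp]: "finite (A m x)" for m x using G by (simp add: A_def)
  have late: "m + 2 \<le> e g" if "\<phi> m x \<le> (1/2) ^ m / 4" "g \<in> A m x" for m x g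
  proof (rule ccontr)
    assume "\<not> m + 2 \<le> e g"
    then have "(1/2::real) ^ (m + 1) \<le> (1/2) ^ e g" by (intro power_decreasing) auto
    also have "\<dots> \<le> \<phi> m x"
      unfolding \<phi>_def using that(2) by (intro member_le_sum) auto
    finally have "(1/2::real) ^ (m + 1) \<le> (1/2) ^ m / 4" using that(1) by linarith
    moreover have "(1/2::real) ^ m > 0" by simp
    ultimately show False by simp
  qed
  have "\<exists>x\<in>C. \<phi> m x \<le> (1/2) ^ m / 4 \<and> thin m x" for m
  proof (induction m)
    case 0
    obtain x where x: "x \<in> C" using C by blast
    have "\<phi> 0 x \<le> (\<Sum>g | g \<in> G \<and> s g = 0. (1/2::real) ^ e g)"
      unfolding \<phi>_def A_def using G by (intro sum_mono2) auto
    also have "\<dots> \<le> (1/2) ^ 0 / 4" using weight[of 0] by simp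
    finally have "\<phi> 0 x \<le> (1/2) ^ 0 / 4" .
    moreover have "thin 0 x"
      unfolding thin_def
    proof (intro ballI impI allI)
      fix g y z assume *: "g \<in> G" "s g \<le> 0" "y \<in> C \<inter> ball x (r ^ 0) \<inter> D g" "z \<in> C \<inter> ball x (r ^ 0) \<inter> D g"
      then have "s g = 0" by simp
      with * se show "dist y z \<le> r ^ e g" 
        by (intro small[OF x *(1)]) (auto dest: se)
    qed
    ultimately show ?case using x by blast
  next
    case (Suc m)
    then obtain x where x: "x \<in> C" "\<phi> m x \<le> (1/2) ^ m / 4" "thin m x" by blast
    obtain F where F: "F \<subseteq> C" "finite F" "card F = 4"
      "\<And>f. f \<in> F \<Longrightarrow> ball f (r ^ Suc m) \<subseteq> ball x (r ^ m)"
      "pairwise (\<lambda>y z. 3 * r ^ Suc m \<le> dist y z) F"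
      using branching[OF x(1), of m] by blast
    define O' where "O' f = {g \<in> A m x. C \<inter> ball f (r ^ Suc m) \<inter> D g \<noteq> {}}" for f
    have finO: "finite (O' f)" for f unfolding O'_def by simp
    \<comment> \<open>An obstacle of diameter at most \<open>r ^ (m + 2)\<close> cannot meet two of the separated balls.\<close>
    have disj: "O' f \<inter> O' f' = {}" if "f \<in> F" "f' \<in> F" "f \<noteq> f'" for f f'
    proof (rule ccontr)
      assume "O' f \<inter> O' f' \<noteq> {}"
      then obtain g where g: "g \<in> A m x" "g \<in> O' f" "g \<in> O' f'" by (auto simp: O'_def)
      have "C \<inter> ball f (r ^ Suc m) \<inter> D g \<noteq> {}" "C \<inter> ball f' (r ^ Suc m) \<inter> D g \<noteq> {}"
        using g unfolding O'_def by blast+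
      then obtain y z where y: "y \<in> C \<inter> ball f (r ^ Suc m) \<inter> D g" and z: "z \<in> C \<inter> ball f' (r ^ Suc m) \<inter> D g"
        by blast
      have "dist y z \<le> r ^ e g"
        using x(3) g(1) y z F(4)[OF that(1)] F(4)[OF that(2)] 
        unfolding thin_def A_def by blast
      also have "\<dots> \<le> r ^ Suc m"
        using late[OF x(2) g(1)] r by (intro power_decreasing) auto
      finally have "dist y z \<le> r ^ Suc m" .
      moreover have "dist f y < r ^ Suc m" "dist f' z < r ^ Suc m" using y z by auto
      moreover have "3 * r ^ Suc m \<le> dist f f'" using F(5) that by (auto simp: pairwise_def)
      moreover have "dist f f' \<le> dist f y + dist y z + dist f' z"
        by (metis add.commute add_left_mono dist_commute dist_triangle dist_triangle_le order_trans)
      ultimately show False by linarith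
    qed
    have "(\<Sum>f\<in>F. \<Sum>g\<in>O' f. (1/2::real) ^ e g) = (\<Sum>g\<in>(\<Union>f\<in>F. O' f). (1/2) ^ e g)"
      using F(2) finO disj by (intro sum.UNION_disjoint[symmetric]) auto
    also have "\<dots> \<le> \<phi> m x"
      unfolding \<phi>_def by (intro sum_mono2) (auto simp: O'_def)
    finally have tot: "(\<Sum>f\<in>F. \<Sum>g\<in>O' f. (1/2::real) ^ e g) \<le> (1/2) ^ m / 4"
      using x(2) by simp
    have "\<exists>f\<in>F. (\<Sum>g\<in>O' f. (1/2::real) ^ e g) \<le> (1/2) ^ m / 16"
    proof (rule ccontr)
      assume "\<not> ?thesis"
      then have "(\<Sum>f\<in>F. (1/2::real) ^ m / 16) < (\<Sum>f\<in>F. \<Sum>g\<in>O' f. (1/2::real) ^ e g)"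
        using F(2,3) by (intro sum_strict_mono) (auto simp: not_le)
      with tot F(3) show False by simp
    qed
    then obtain f where f: "f \<in> F" "(\<Sum>g\<in>O' f. (1/2::real) ^ e g) \<le> (1/2) ^ m / 16" by blast
    have sub: "ball f (r ^ Suc m) \<subseteq> ball x (r ^ m)" using F(4) f(1) .
    have fC: "f \<in> C" using F f by auto
    let ?N = "{g \<in> G. s g = Suc m}"
    have "A (Suc m) f \<subseteq> O' f \<union> ?N"
      using sub unfolding A_def O'_def by (auto simp: le_Suc_eq)
    then have "\<phi> (Suc m) f \<le> (\<Sum>g\<in>O' f \<union> ?N. (1/2::real) ^ e g)"
      unfolding \<phi>_def using finO G by (intro sum_mono2) auto
    also have "\<dots> = (\<Sum>g\<in>O' f. (1/2::real) ^ e g) + (\<Sum>g\<in>?N. (1/2::real) ^ e g)"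
      using finO G by (intro sum.union_disjoint) (auto simp: O'_def A_def)
    also have "\<dots> \<le> (1/2) ^ m / 16 + (1/2) ^ Suc m / 8"
      using f(2) weight[of "Suc m"] by (intro add_mono)
    finally have pot: "\<phi> (Suc m) f \<le> (1/2) ^ Suc m / 4" by simp
    have "thin (Suc m) f"
      unfolding thin_def
    proof (intro ballI impI allI)
      fix g y z assume g: "g \<in> G" "s g \<le> Suc m" and
        yz: "y \<in> C \<inter> ball f (r ^ Suc m) \<inter> D g" "z \<in> C \<inter> ball f (r ^ Suc m) \<inter> D g"
      show "dist y z \<le> r ^ e g"
      proof (cases "s g \<le> m")
        case True
        with x(3) g yz sub show ?thesis unfolding thin_def by blast
      next
        case False
        then have s: "s g = Suc m" using g by simp
        have "C \<inter> ball f (r ^ s g) \<inter> D h = {}" if h: "h \<in> G" "e h \<le> s g" for h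
        proof (rule ccontr)
          assume ne: "\<not> ?thesis"
          have "s h \<le> m" using se[OF h(1)] h(2) s by simp
          with ne h sub s have "h \<in> A m x" unfolding A_def by auto
          with late[OF x(2)] h(2) s show False by fastforce
        qed
        with yz s fC g show ?thesis by (intro small[of f g]) auto
      qed
    qed
    with pot fC show ?case by blast
  qed
  then obtain x where x: "x \<in> C" "\<phi> (Max (e ` G)) x \<le> (1/2) ^ (Max (e ` G)) / 4" by blast
  have "x \<notin> D g" if "g \<in> G" for g
  proof
    assume "x \<in> D g"
    have "e g \<le> Max (e ` G)" using G that by simp
    moreover from this have "g \<in> A (Max (e ` G)) x"
      unfolding A_def using that se[OF that] x(1) \<open>x \<in> D g\<close> r by auto
    ultimately show False using late[OF x(2)] by fastforce
  qed
  with x(1) show ?thesis by blast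
qed

text \<open>
The obstacle \<open>D t n c\<close> has size exponent \<open>a t + (t + 5) * n\<close> and becomes visible
\<open>(t + 5) * (c + 1)\<close> stages earlier. At a fixed stage there is at most one \<open>n\<close> for given
\<open>t\<close> and \<open>c\<close>, so the relative weight that becomes visible there is at most the sum of
\<open>(1/2) ^ ((t + 5) * (c + 1))\<close>, which is dominated by the double geometric series with sum
\<open>4 / 32\<close>. This is why the \<open>t\<close>-th family must have the scale \<open>r ^ (t + 5)\<close>: with a fixed
scale, infinitely many families would be too heavy. Compactness extends the result from
finitely many obstacles to all of them.
\<close>

lemma avoid_obstacle_families:
  fixes C :: "'a::metric_space set" and D :: "nat \<Rightarrow> nat \<Rightarrow> nat \<Rightarrow> 'a set" and a :: "nat \<Rightarrow> nat"
  assumes r: "0 < r" "r \<le> 1"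
    and C: "compact C" "C \<noteq> {}"
    and branching: "\<And>m x. x \<in> C \<Longrightarrow> \<exists>F. F \<subseteq> C \<and> finite F \<and> card F = 4 \<and>
       (\<forall>f\<in>F. ball f (r ^ Suc m) \<subseteq> ball x (r ^ m)) \<and> pairwise (\<lambda>y z. 3 * r ^ Suc m \<le> dist y z) F"
    and open_D: "\<And>t n c. open (D t n c)"
    and empty_D: "\<And>t n c. n < c \<Longrightarrow> D t n c = {}"
    and a: "\<And>t. t + 5 \<le> a t"
    and small: "\<And>t n c y z. c \<le> n \<Longrightarrow> y \<in> C \<inter> D t n c \<Longrightarrow> z \<in> C \<inter> D t n c \<Longrightarrow>
        dist y z < 2 * r ^ (a t + (t + 5) * n - (t + 5) * (c + 1)) \<Longrightarrow>
        dist y z \<le> r ^ (a t + (t + 5) * n) \<or> (\<exists>n' c'. n' + c + 1 \<le> n \<and> y \<in> D t n' c')"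
  shows "\<exists>x\<in>C. \<forall>t n c. x \<notin> D t n c"
proof -
  define e :: "nat \<times> nat \<times> nat \<Rightarrow> nat" where "e = (\<lambda>(t, n, c). a t + (t + 5) * n)"
  define s :: "nat \<times> nat \<times> nat \<Rightarrow> nat" where "s = (\<lambda>(t, n, c). a t + (t + 5) * n - (t + 5) * (c + 1))"
  define E :: "nat \<times> nat \<times> nat \<Rightarrow> 'a set" where "E = (\<lambda>(t, n, c). D t n c)"
  define G where "G T = {(t, n, c). c \<le> n \<and> a t + (t + 5) * n \<le> T}" for T :: nat
  have s_e: "s (t, n, c) + (t + 5) * (c + 1) = e (t, n, c)" if "c \<le> n" for t n c
  proof -
    have "(t + 5) * (c + 1) = (t + 5) * c + (t + 5)" by simp
    moreover have "(t + 5) * c \<le> (t + 5) * n" using that by (intro mult_left_mono) auto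
    ultimately have "(t + 5) * (c + 1) \<le> a t + (t + 5) * n" using a[of t] by linarith
    then show ?thesis unfolding s_def e_def prod.case by (rule le_add_diff_inverse2)
  qed
  have bound: "t \<le> T" "n \<le> T" "c \<le> T" if "(t, n, c) \<in> G T" for t n c T
  proof -
    have 1: "a t + (t + 5) * n \<le> T" "c \<le> n" using that by (auto simp: G_def)
    have "1 * n \<le> (t + 5) * n" by (intro mult_right_mono) auto
    with 1 a[of t] show "t \<le> T" "n \<le> T" "c \<le> T" by linarith+
  qed
  have finG: "finite (G T)" for T
    by (rule finite_subset[of _ "{..T} \<times> {..T} \<times> {..T}"]) (auto dest: bound)
  have avoid: "\<exists>x\<in>C. \<forall>g\<in>G T. x \<notin> E g" for T
  proof (rule avoid_finitely_many_obstacles[OF r C(2) branching finG, where s = s and e = e])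
    fix g assume "g \<in> G T"
    moreover obtain t n c where "g = (t, n, c)" by (cases g)
    ultimately show "s g < e g" using s_e[of c n t] by (auto simp: G_def)
  next
    fix m
    let ?S = "{g \<in> G T. s g = m}"
    let ?h = "\<lambda>(t, n, c). (t, c) :: nat \<times> nat"
    have inj: "inj_on ?h ?S"
    proof (rule inj_onI)
      fix g g' assume *: "g \<in> ?S" "g' \<in> ?S" "?h g = ?h g'"
      obtain t n c where g: "g = (t, n, c)" by (cases g)
      with * obtain n' where g': "g' = (t, n', c)" by (cases g') auto
      have "e g = e g'" using * s_e[of c n t] s_e[of c n' t] by (auto simp: G_def g g')
      then show "g = g'" by (simp add: e_def g g')
    qed
    have "(\<Sum>k\<le>T. (1/2::real) ^ k) = 2 - (1/2) ^ T" by (induction T) auto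
    then have geo: "(\<Sum>k\<le>T. (1/2::real) ^ k) \<le> 2" by simp
    have term_le: "(1/2::real) ^ e g \<le> (1/2) ^ m / 32 * (case ?h g of (t, c) \<Rightarrow> (1/2) ^ t * (1/2) ^ c)"
      if "g \<in> ?S" for g
    proof -
      obtain t n c where g: "g = (t, n, c)" by (cases g)
      have "c \<le> n" using that g by (auto simp: G_def)
      then have "e g = m + (t + 5) * (c + 1)" using that g s_e by fastforce
      also have "\<dots> = m + 5 + t + c + (t * c + 4 * c)" by (simp add: algebra_simps)
      finally have "(1/2::real) ^ e g \<le> (1/2) ^ (m + 5 + t + c)" by (intro power_decreasing) auto
      also have "\<dots> = (1/2) ^ m / 32 * ((1/2) ^ t * (1/2) ^ c)"
        by (simp add: power_add power_divide[of 1 2 5])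
      finally show ?thesis by (simp add: g)
    qed
    have "(\<Sum>g\<in>?S. (1/2::real) ^ e g)
        \<le> (\<Sum>g\<in>?S. (1/2) ^ m / 32 * (case ?h g of (t, c) \<Rightarrow> (1/2) ^ t * (1/2) ^ c))"
      using term_le by (intro sum_mono)
    also have "\<dots> = (1/2) ^ m / 32 * (\<Sum>(t, c)\<in>?h ` ?S. (1/2) ^ t * (1/2) ^ c)"
      using inj by (simp add: sum_distrib_left sum.reindex)
    also have "\<dots> \<le> (1/2) ^ m / 32 * (\<Sum>(t, c)\<in>{..T} \<times> {..T}. (1/2) ^ t * (1/2) ^ c)"
      by (intro mult_left_mono sum_mono2) (auto dest: bound)
    also have "(\<Sum>(t, c)\<in>{..T} \<times> {..T}. (1/2::real) ^ t * (1/2) ^ c) = (\<Sum>k\<le>T. (1/2) ^ k) * (\<Sum>k\<le>T. (1/2) ^ k)"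
      by (simp add: sum_product sum.cartesian_product)
    also have "\<dots> \<le> 2 * 2" using geo by (intro mult_mono) (auto intro: sum_nonneg)
    finally show "(\<Sum>g\<in>?S. (1/2::real) ^ e g) \<le> (1/2) ^ m / 8" by simp
  next
    fix x g y z
    assume x: "x \<in> C" and g: "g \<in> G T" and
      free: "\<And>h. h \<in> G T \<Longrightarrow> e h \<le> s g \<Longrightarrow> C \<inter> ball x (r ^ s g) \<inter> E h = {}" and
      y: "y \<in> C \<inter> ball x (r ^ s g) \<inter> E g" and z: "z \<in> C \<inter> ball x (r ^ s g) \<inter> E g"
    obtain t n c where gt: "g = (t, n, c)" by (cases g)
    have cn: "c \<le> n" and eT: "e g \<le> T" using g gt by (auto simp: G_def e_def)
    have "dist y z < 2 * r ^ s g"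
      using y z dist_triangle3[of y z x] by (auto simp: dist_commute)
    then consider "dist y z \<le> r ^ e g" | n' c' where "n' + c + 1 \<le> n" "y \<in> D t n' c'"
      using small[of c n y t z] y z cn by (auto simp: gt E_def s_def e_def)
    then show "dist y z \<le> r ^ e g"
    proof cases
      case 2
      have "c' \<le> n'" using empty_D[of n' c' t] 2 by (cases "c' \<le> n'") auto
      have "(t + 5) * (n' + (c + 1)) \<le> (t + 5) * n" using 2 by (intro mult_left_mono) auto
      then have "e (t, n', c') + (t + 5) * (c + 1) \<le> e g" by (simp add: e_def gt algebra_simps)
      then have le: "e (t, n', c') \<le> s g" using s_e[OF cn, of t] gt by simp
      moreover have "(t, n', c') \<in> G T"
        using le eT s_e[OF cn, of t] \<open>c' \<le> n'\<close> by (auto simp: G_def e_def gt)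
      ultimately have "C \<inter> ball x (r ^ s g) \<inter> E (t, n', c') = {}" by (intro free)
      with y 2 show ?thesis by (auto simp: E_def)
    qed
  qed
  define K where "K T = (\<Inter>g\<in>G T. - E g)" for T
  have "C \<inter> \<Inter> (range K) \<noteq> {}"
  proof (rule compact_imp_fip_image[OF C(1)])
    fix T
    show "closed (K T)" unfolding K_def
      using open_D by (intro closed_INT ballI) (auto simp: E_def split: prod.splits)
  next
    fix \<T> :: "nat set" assume \<T>: "finite \<T>"
    obtain x where x: "x \<in> C" "\<forall>g\<in>G (Max \<T>). x \<notin> E g" using avoid by blast
    have "G T \<subseteq> G (Max \<T>)" if "T \<in> \<T>" for T
      using Max_ge[OF \<T> that] by (auto simp: G_def)
    with x have "x \<in> C \<inter> \<Inter> (K ` \<T>)" unfolding K_def by blast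
    then show "C \<inter> \<Inter> (K ` \<T>) \<noteq> {}" by blast
  qed
  then obtain x where x: "x \<in> C" "\<And>T. x \<in> K T" by auto
  have "x \<notin> D t n c" for t n c
  proof (cases "c \<le> n")
    case True
    then have "(t, n, c) \<in> G (a t + (t + 5) * n)" by (simp add: G_def)
    with x(2) show ?thesis unfolding K_def E_def by fastforce
  qed (use empty_D in auto)
  with x(1) show ?thesis by blast
qed

section \<open>Rational points and lines near a vertical line\<close>

lemma step_bracket:
  fixes f :: "nat \<Rightarrow> real"
  assumes "f 0 \<le> x" "x < f N"
  obtains n where "f n \<le> x" "x < f (Suc n)"
proof -
  define k where "k = (LEAST n. x < f n)"
  have k: "x < f k" unfolding k_def using assms(2) by (rule LeastI)
  then have "k \<noteq> 0" using assms(1) by (metis not_le)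
  then obtain n where n: "k = Suc n" using not0_implies_Suc by blast
  then have "\<not> x < f n" unfolding k_def by (metis lessI not_less_Least)
  with k n show thesis by (intro that[of n]) auto
qed

lemma le_of_powr_le:
  fixes a x y :: real
  assumes "0 < a" "0 \<le> y" "x powr a \<le> y powr a"
  shows "x \<le> y"
  using powr_less_mono2[of a y x] assms by fastforce

lemma int_abs_less_one: "\<bar>real_of_int z\<bar> < 1 \<Longrightarrow> z = 0"
  by linarith

text \<open>
The hypotheses say that both equations describe the same line. It meets the vertical line
over \<open>x\<close> in one point \<open>Y\<close>, and both \<open>y1\<close> and \<open>y2\<close> are close to \<open>Y\<close>.
\<close>

lemma close_on_same_line:
  fixes A1 B1 C1 A2 B2 C2 :: real
  assumes B: "0 < B1" "0 < B2" and par: "A1 * B2 = A2 * B1" "B1 * C2 = B2 * C1"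
  assumes "\<bar>A1 * x + B1 * y1 + C1\<bar> \<le> \<delta> / q1" "\<bar>A2 * x + B2 * y2 + C2\<bar> \<le> \<delta> / q2"
   and q: "0 < q1" "0 < q2" "H \<le> q1 * B1" "H \<le> q2 * B2" "0 < H" "0 \<le> \<delta>"
  shows "\<bar>y1 - y2\<bar> \<le> 2 * \<delta> / H"
proof -
  define Y where "Y = - (A1 * x + C1) / B1"
  have one: "\<bar>y - Y\<bar> \<le> \<delta> / H" if "\<bar>A * x + B * y + C\<bar> \<le> \<delta> / q" "0 < B" "0 < q" "H \<le> q * B" "A * x + C = - B * Y"
    for A B C y q
  proof -
    have "B * \<bar>y - Y\<bar> = \<bar>A * x + B * y + C\<bar>"
    proof -
      have "A * x + B * y + C = B * (y - Y)" using that(5) by (simp add: algebra_simps)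
      then show ?thesis using that(2) by (simp add: abs_mult)
    qed
    with that(1) have "B * \<bar>y - Y\<bar> \<le> \<delta> / q" by simp
    then have "\<bar>y - Y\<bar> \<le> \<delta> / q / B" using that(2) by (simp only: pos_le_divide_eq mult.commute)
    also have "\<dots> = \<delta> / (q * B)" by simp
    finally have "\<bar>y - Y\<bar> \<le> \<delta> / (q * B)" .
    also have "\<dots> \<le> \<delta> / H" using q that by (intro divide_left_mono) auto
    finally show ?thesis .
  qed
  have "\<bar>y1 - Y\<bar> \<le> \<delta> / H" using assms by (intro one[of A1 B1 y1 C1 q1]) (auto simp: Y_def)
  moreover have "A2 * x + C2 = - B2 * Y"
  proof -
    have "B1 * (A2 * x + C2) = B2 * (A1 * x + C1)" using par by (simp add: algebra_simps)
    then show ?thesis using B by (simp add: Y_def field_simps)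
  qed
  then have "\<bar>y2 - Y\<bar> \<le> \<delta> / H" using assms by (intro one[of A2 B2 y2 C2 q2]) auto
  ultimately have "\<bar>y1 - y2\<bar> \<le> \<delta> / H + \<delta> / H" by linarith
  then show ?thesis by simp
qed


text \<open>
The cross product of the coefficient vectors of two lines gives homogeneous coordinates of
their intersection. By Cramer's rule the intersection is close to every point \<open>(x, y)\<close> at
which both linear forms are small.
\<close>

lemma intersection_near:
  fixes A1 B1 C1 A2 B2 C2 x y a b w :: real
  assumes A: "\<bar>A1\<bar> \<le> a" "\<bar>A2\<bar> \<le> a" and B: "\<bar>B1\<bar> \<le> b" "\<bar>B2\<bar> \<le> b"
    and E: "\<bar>A1 * x + B1 * y + C1\<bar> \<le> w" "\<bar>A2 * x + B2 * y + C2\<bar> \<le> w"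
  shows "\<bar>A1 * B2 - A2 * B1\<bar> \<le> 2 * a * b"
    and "\<bar>(A1 * B2 - A2 * B1) * x - (B1 * C2 - B2 * C1)\<bar> \<le> 2 * b * w"
    and "\<bar>(A1 * B2 - A2 * B1) * y - (C1 * A2 - C2 * A1)\<bar> \<le> 2 * a * w"
proof -
  have det: "\<bar>k * u - z * v\<bar> \<le> 2 * s * t"
    if "\<bar>k\<bar> \<le> s" "\<bar>z\<bar> \<le> s" "\<bar>u\<bar> \<le> t" "\<bar>v\<bar> \<le> t" for k u z v s t :: real
  proof -
    have "\<bar>k * u - z * v\<bar> \<le> \<bar>k\<bar> * \<bar>u\<bar> + \<bar>z\<bar> * \<bar>v\<bar>" by (metis abs_mult abs_triangle_ineq4)
    also have "\<dots> \<le> s * t + s * t" using that by (intro add_mono mult_mono) auto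
    finally show ?thesis by simp
  qed
  show "\<bar>A1 * B2 - A2 * B1\<bar> \<le> 2 * a * b" by (rule det[OF A B(2) B(1)])
  have "(A1 * B2 - A2 * B1) * x - (B1 * C2 - B2 * C1) =
      B2 * (A1 * x + B1 * y + C1) - B1 * (A2 * x + B2 * y + C2)" by (simp add: algebra_simps)
  then show "\<bar>(A1 * B2 - A2 * B1) * x - (B1 * C2 - B2 * C1)\<bar> \<le> 2 * b * w"
    using det[OF B(2) B(1) E] by simp
  have "(A1 * B2 - A2 * B1) * y - (C1 * A2 - C2 * A1) =
      A1 * (A2 * x + B2 * y + C2) - A2 * (A1 * x + B1 * y + C1)" by (simp add: algebra_simps)
  then show "\<bar>(A1 * B2 - A2 * B1) * y - (C1 * A2 - C2 * A1)\<bar> \<le> 2 * a * w"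
    using det[OF A E(2) E(1)] by simp
qed

text \<open>
Two distinct points determine a line. In homogeneous coordinates, both points are
orthogonal to both coefficient vectors, so they are proportional to the cross product
unless it vanishes.
\<close>

lemma parallel_or_same_point:
  fixes A1 B1 C1 A2 B2 C2 p1 r1 q1 p2 r2 q2 :: int
  assumes "A1 * p1 + B1 * r1 + C1 * q1 = 0" "A2 * p1 + B2 * r1 + C2 * q1 = 0"
    and "A1 * p2 + B1 * r2 + C1 * q2 = 0" "A2 * p2 + B2 * r2 + C2 * q2 = 0"
    and q: "q1 \<noteq> 0" "q2 \<noteq> 0"
  shows "A1 * B2 = A2 * B1 \<and> B1 * C2 = B2 * C1 \<or> r1 * q2 = r2 * q1"
proof -
  define d where "d = A1 * B2 - A2 * B1"
  define p where "p = B1 * C2 - B2 * C1"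
  define r where "r = C1 * A2 - C2 * A1"
  have cross: "d * p' = p * q'" "d * r' = r * q'"
    if "A1 * p' + B1 * r' + C1 * q' = 0" "A2 * p' + B2 * r' + C2 * q' = 0" for p' r' q'
    using that unfolding d_def p_def r_def by algebra+
  show ?thesis
  proof (cases "d = 0")
    case True
    then have "p * q1 = 0" using cross(1)[OF assms(1,2)] by simp
    then have "p = 0" using q by simp
    with True show ?thesis by (simp add: d_def p_def)
  next
    case False
    have "d * (r1 * q2) = (d * r1) * q2" by simp
    also have "\<dots> = d * r2 * q1" using cross(2)[OF assms(1,2)] cross(2)[OF assms(3,4)] by simp
    finally show ?thesis using False by simp
  qed
qed

text \<open>
The setting for a single pair of weights with \<open>j > 0\<close>. The last assumption is the only
thing that has to be known about \<open>\<theta>\<close>: through a rational point \<open>(p / q, r / q)\<close> whose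
abscissa is a good approximation of \<open>\<theta>\<close> there is a line of small coefficients that is not
vertical. The exponent in the smallness condition on \<open>\<epsilon>\<close> is the one that is needed in the
class \<open>c = 0\<close> below.
\<close>

locale weighted_line_system =
  fixes i j \<theta> \<epsilon> R :: real
  assumes i: "0 \<le> i" and j: "0 < j" and ij: "i + j = 1"
    and R: "8 \<le> R"
    and \<epsilon>: "0 < \<epsilon>" and \<epsilon>_small: "12 * \<epsilon> * R powr ((5 + 1 / j) / j + 3) < 1"
    and line_exists: "\<And>p r q :: int. 0 < q \<Longrightarrow> \<bar>of_int q * \<theta> - of_int p\<bar> < \<epsilon> * of_int q powr - i \<Longrightarrow>
      \<exists>A B C :: int. 0 < B \<and> A * p + B * r + C * q = 0 \<and>
        \<bar>of_int A\<bar> \<le> of_int q powr i \<and> of_int B \<le> of_int q powr j"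
begin

definition incident :: "int \<Rightarrow> int \<Rightarrow> int \<Rightarrow> int \<Rightarrow> int \<Rightarrow> int \<Rightarrow> bool" where
  "incident p r q A B C \<longleftrightarrow> 0 < q \<and> 0 < B \<and> A * p + B * r + C * q = 0 \<and>
     \<bar>of_int A\<bar> \<le> of_int q powr i \<and> of_int B \<le> of_int q powr j \<and>
     \<bar>of_int q * \<theta> - of_int p\<bar> < \<epsilon> * of_int q powr - i"

text \<open>
The ratio \<open>q\<^sup>j / B\<close> tells by how much a line is better than the pigeonhole principle
guarantees. Class \<open>0\<close> begins at \<open>0\<close> instead of \<open>1\<close>, the least possible ratio, so that all
classes can be treated as intervals between consecutive thresholds. The summand
\<open>4 + 1 / j\<close> provides the powers of \<open>R\<close> that absorb all losses in
\<open>intersection_is_dangerous\<close>.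
\<close>

definition thr :: "nat \<Rightarrow> real" where
  "thr c = (if c = 0 then 0 else R powr ((real c + 4 + 1 / j) / j))"

text \<open>
The numbers \<open>y\<close> to be avoided, sorted by the height \<open>q B\<close> of the line and by its class.
The height is the natural size parameter because the line determines \<open>y\<close> up to an error of
order \<open>\<epsilon> / (q B)\<close>.
\<close>

definition obstacle :: "nat \<Rightarrow> nat \<Rightarrow> real set" where
  "obstacle n c = {y. \<exists>p r q A B C. incident p r q A B C \<and>
     \<bar>of_int q * y - of_int r\<bar> < \<epsilon> * of_int q powr - j \<and>
     R ^ n \<le> of_int q * of_int B \<and> of_int q * of_int B < R ^ Suc n \<and>
     thr c \<le> of_int q powr j / of_int B \<and> of_int q powr j / of_int B < thr (Suc c)}"

lemma j_le_1: "j \<le> 1" using i ij by simp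

lemma inv_j_ge_1: "1 \<le> 1 / j" using j j_le_1 by simp

lemma R_gt_1: "1 < R" using R by simp

lemma \<epsilon>_R_cubed: "12 * \<epsilon> * R ^ 3 < 1"
proof -
  have "R ^ 3 = R powr 3" using R by simp
  also have "\<dots> \<le> R powr ((5 + 1 / j) / j + 3)" using R j by (intro powr_mono) auto
  finally have "12 * \<epsilon> * R ^ 3 \<le> 12 * \<epsilon> * R powr ((5 + 1 / j) / j + 3)" using \<epsilon> by simp
  with \<epsilon>_small show ?thesis by simp
qed

lemma \<epsilon>_lt: "96 * \<epsilon> < 1"
proof -
  have "8 ^ 1 \<le> R ^ 1" using R by simp
  also have "\<dots> \<le> R ^ 3" using R by (intro power_increasing) auto
  finally have "12 * \<epsilon> * 8 \<le> 12 * \<epsilon> * R ^ 3" using \<epsilon> by simp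
  with \<epsilon>_R_cubed show ?thesis by simp
qed

lemma open_obstacle: "open (obstacle n c)"
proof -
  have eq: "obstacle n c = (\<Union>(p, r, q, A, B, C) \<in> {(p, r, q, A, B, C). incident p r q A B C \<and>
     R ^ n \<le> of_int q * of_int B \<and> of_int q * of_int B < R ^ Suc n \<and>
     thr c \<le> of_int q powr j / of_int B \<and> of_int q powr j / of_int B < thr (Suc c)}.
     {y. \<bar>of_int q * y - of_int r\<bar> < \<epsilon> * of_int q powr - j})"
    unfolding obstacle_def by fastforce
  show ?thesis unfolding eq
    by (intro open_UN ballI) (auto intro!: open_Collect_less continuous_intros split: prod.splits)
qed

lemma obstacle_cover:
  assumes "incident p r q A B C" "\<bar>of_int q * y - of_int r\<bar> < \<epsilon> * of_int q powr - j"
  obtains n c where "y \<in> obstacle n c" "R ^ n \<le> of_int q * of_int B"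
proof -
  have q: "0 < q" "0 < B" using assms(1) by (auto simp: incident_def)
  then have "1 \<le> q * B" using mult_pos_pos[of q B] by linarith
  then have qB: "1 \<le> real_of_int q * of_int B" by (metis of_int_1 of_int_le_iff of_int_mult)
  obtain N where N: "real_of_int q * of_int B < R ^ N" using R_gt_1 real_arch_pow by blast
  have "R ^ 0 \<le> real_of_int q * of_int B" using qB by simp
  then obtain n where n: "R ^ n \<le> real_of_int q * of_int B" "real_of_int q * of_int B < R ^ Suc n"
    using N by (rule step_bracket)
  have "thr 0 \<le> real_of_int q powr j / of_int B" using q by (simp add: thr_def)
  obtain K where K: "real_of_int q powr j / of_int B < R ^ K" using R_gt_1 real_arch_pow by blast
  also have "R ^ K = R powr real K" using R by (simp add: powr_realpow)
  also have "\<dots> \<le> thr (Suc K)"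
  proof -
    have "real K * 1 \<le> (real (Suc K) + 4 + 1 / j) * (1 / j)"
      using inv_j_ge_1 by (intro mult_mono) auto
    then show ?thesis unfolding thr_def using R by (auto intro!: powr_mono)
  qed
  finally have "real_of_int q powr j / of_int B < thr (Suc K)" .
  with \<open>thr 0 \<le> _\<close> obtain c where "thr c \<le> real_of_int q powr j / of_int B"
    "real_of_int q powr j / of_int B < thr (Suc c)"
    by (rule step_bracket)
  with n assms have "y \<in> obstacle n c" unfolding obstacle_def by blast
  from this n(1) show thesis by (rule that)
qed

lemma powr_le_of_height_less:
  assumes "1 \<le> (q::real)" "B * q < R ^ Suc n" "1 \<le> B"
  shows "q powr j \<le> R powr (real (Suc n) * j)"
proof -
  have "q * 1 \<le> q * B" using assms by (intro mult_left_mono) auto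
  then have "q \<le> R ^ Suc n" using assms(2) by (simp add: mult.commute)
  then have "q powr j \<le> (R ^ Suc n) powr j" using assms j by (intro powr_mono2) auto
  also have "R ^ Suc n = R powr real (Suc n)" using R by (intro powr_realpow[symmetric]) auto
  also have "(R powr real (Suc n)) powr j = R powr (real (Suc n) * j)" by (rule powr_powr)
  finally show ?thesis .
qed

lemma obstacle_empty:
  assumes "n < c"
  shows "obstacle n c = {}"
proof (rule ccontr)
  assume "obstacle n c \<noteq> {}"
  then obtain p r q A B C where *: "incident p r q A B C" "real_of_int q * of_int B < R ^ Suc n"
    "thr c \<le> real_of_int q powr j / of_int B" by (auto simp: obstacle_def)
  have q: "1 \<le> real_of_int q" "1 \<le> real_of_int B" using *(1) by (auto simp: incident_def)
  have "R powr ((real c + 4 + 1 / j) / j) = thr c" using assms by (simp add: thr_def)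
  also have "\<dots> \<le> real_of_int q powr j / of_int B" by fact
  also have "\<dots> \<le> real_of_int q powr j" using q by (simp add: divide_le_eq mult_le_cancel_left1)
  also have "\<dots> \<le> R powr (real (Suc n) * j)"
    using *(2) q by (intro powr_le_of_height_less[of _ "of_int B"]) (auto simp: mult.commute)
  finally have exps: "(real c + 4 + 1 / j) / j \<le> real (Suc n) * j" using R_gt_1 by simp
  have j': "1 / j > 0" using j by simp
  have "real c + 4 \<le> real c + 4 + 1 / j" using j' by simp
  also have "\<dots> \<le> (real c + 4 + 1 / j) / j"
    using j j_le_1 by (subst le_divide_eq) (simp add: mult_left_le)
  also note exps
  also have "real (Suc n) * j \<le> real (Suc n)" using j_le_1 by (intro mult_left_le) auto
  finally have "real c + 4 \<le> real (Suc n)" .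
  with assms show False by simp
qed

text \<open>
Both terms of \<open>A (q \<theta> - p) + B (q y - r)\<close> are at most \<open>\<epsilon>\<close>, because the bounds on \<open>A\<close> and
\<open>B\<close> are reciprocal to the quality of the approximations of \<open>\<theta>\<close> and \<open>y\<close>.
\<close>

lemma incident_line_value:
  assumes "incident p r q A B C" "\<bar>of_int q * y - of_int r\<bar> < \<epsilon> * of_int q powr - j"
  shows "\<bar>of_int A * \<theta> + of_int B * y + of_int C\<bar> \<le> 2 * \<epsilon> / of_int q"
proof -
  have q: "0 < real_of_int q" and A: "\<bar>real_of_int A\<bar> \<le> of_int q powr i"
    and B: "\<bar>real_of_int B\<bar> \<le> of_int q powr j"
    and p: "\<bar>of_int q * \<theta> - of_int p\<bar> \<le> \<epsilon> * of_int q powr - i"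
    using assms(1) by (auto simp: incident_def)
  have "real_of_int (A * p + B * r + C * q) = 0" using assms(1) by (simp add: incident_def)
  then have "of_int q * (of_int A * \<theta> + of_int B * y + of_int C) =
      of_int A * (of_int q * \<theta> - of_int p) + of_int B * (of_int q * y - of_int r)"
    by (simp add: algebra_simps)
  then have "of_int q * \<bar>of_int A * \<theta> + of_int B * y + of_int C\<bar> =
      \<bar>of_int A * (of_int q * \<theta> - of_int p) + of_int B * (of_int q * y - of_int r)\<bar>"
    using q by (metis abs_mult abs_of_pos)
  also have "\<dots> \<le> \<bar>of_int A\<bar> * \<bar>of_int q * \<theta> - of_int p\<bar> + \<bar>of_int B\<bar> * \<bar>of_int q * y - of_int r\<bar>"
    by (metis abs_mult abs_triangle_ineq)
  also have "\<dots> \<le> of_int q powr i * (\<epsilon> * of_int q powr - i) + of_int q powr j * (\<epsilon> * of_int q powr - j)"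
    using A B p assms(2) by (intro add_mono mult_mono) auto
  also have "\<dots> = 2 * \<epsilon>"
  proof -
    have "of_int q powr e * (\<epsilon> * of_int q powr - e) = \<epsilon>" for e
      using q by (simp add: powr_minus field_simps)
    from this[of i] this[of j] show ?thesis by linarith
  qed
  finally show ?thesis using q by (simp add: field_simps)
qed

text \<open>
Height and class together determine \<open>q\<^sup>1\<^sup>+\<^sup>j\<close>, which is the product of the ratio \<open>q\<^sup>j / B\<close> and
the height \<open>q B\<close>, up to a factor \<open>R\<^sup>1\<^sup>+\<^sup>1\<^sup>/\<^sup>j\<close>. So all denominators of one class agree up to a
factor \<open>R\<^sup>1\<^sup>/\<^sup>j\<close>.
\<close>

lemma height_window:
  assumes q: "1 \<le> (q::real)" "1 \<le> B" and H: "R ^ n \<le> q * B" "q * B < R ^ Suc n"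
    and c: "thr (Suc c) \<le> q powr j / B" "q powr j / B < thr (Suc (Suc c))"
    and u: "u = (real c + 5 + 1 / j) / j" and x: "x = (u + n) / (1 + j)"
  shows "R powr x \<le> q" "q \<le> R powr (x + 1 / j)" "B \<le> R powr ((x + 1 / j) * j - u)"
proof -
  have q0: "q powr (1 + j) = (q powr j / B) * (q * B)" using q by (simp add: powr_add)
  have thr1: "thr (Suc c) = R powr u" unfolding thr_def u by (simp add: add_ac)
  have thr2: "thr (Suc (Suc c)) = R powr (u + 1 / j)"
    unfolding thr_def u by (simp add: add_ac add_divide_distrib)
  have Rn: "R ^ n = R powr n" "R ^ Suc n = R powr (n + 1)"
    using R by (simp_all add: powr_realpow powr_add)
  have x1: "x * (1 + j) = u + n" using j unfolding x by (simp add: field_simps)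
  have "R powr (x * (1 + j)) = R powr u * R powr n" by (simp add: x1 powr_add)
  also have "\<dots> \<le> (q powr j / B) * (q * B)"
    using c(1) H(1) q R unfolding thr1 Rn by (intro mult_mono) auto
  finally have "(R powr x) powr (1 + j) \<le> q powr (1 + j)" by (simp only: q0 powr_powr)
  with j q show "R powr x \<le> q" by (elim le_of_powr_le[rotated 2]) auto
  have "q powr (1 + j) \<le> R powr (u + 1 / j) * R powr (n + 1)"
    unfolding q0 using c(2) H(2) q R unfolding thr2 Rn by (intro mult_mono) auto
  also have "\<dots> = (R powr (x + 1 / j)) powr (1 + j)"
  proof -
    have "(x + L) * (1 + j) = x * (1 + j) + L + L * j" for L by (simp add: algebra_simps)
    from this[of "1 / j"] have "(x + 1 / j) * (1 + j) = u + 1 / j + (n + 1)"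
      using x1 j by simp
    then show ?thesis by (simp add: powr_powr powr_add[symmetric])
  qed
  finally have "q powr (1 + j) \<le> (R powr (x + 1 / j)) powr (1 + j)" .
  with j show q2: "q \<le> R powr (x + 1 / j)" by (elim le_of_powr_le[rotated 2]) auto
  have "B \<le> q powr j / R powr u" using c(1) q R unfolding thr1 by (simp add: field_simps)
  also have "\<dots> \<le> (R powr (x + 1 / j)) powr j / R powr u"
    using q2 q j by (intro divide_right_mono powr_mono2) auto
  also have "\<dots> = R powr ((x + 1 / j) * j - u)" by (simp add: powr_powr powr_diff)
  finally show "B \<le> R powr ((x + 1 / j) * j - u)" .
qed

text \<open>
The heart of the argument. The lines of class \<open>c + 1\<close> have coefficients \<open>B\<close> that are
smaller than \<open>q\<^sup>j\<close> by the factor \<open>R\<^sup>u\<close>, and so the denominator of the intersection of two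
such lines is smaller than \<open>q\<close> by nearly the same factor. The intersection is then so
close to \<open>(\<theta>, y)\<close> that, in relation to its own denominator, it forbids \<open>y\<close> again, and its
height is below \<open>R ^ (n - c - 2)\<close>. If the lines are parallel, the same estimate forces the
integer \<open>B1 C2 - B2 C1\<close> to vanish, so that they coincide.
\<close>

lemma intersection_is_dangerous:
  assumes x: "0 \<le> x" and u: "u = (real c + 5 + 1 / j) / j" and xu: "x * (1 + j) = u + n"
    and A: "\<bar>A1\<bar> \<le> R powr ((x + 1 / j) * i)" "\<bar>A2\<bar> \<le> R powr ((x + 1 / j) * i)"
    and B: "\<bar>B1\<bar> \<le> R powr ((x + 1 / j) * j - u)" "\<bar>B2\<bar> \<le> R powr ((x + 1 / j) * j - u)"
    and E: "\<bar>A1 * \<theta> + B1 * y + C1\<bar> \<le> 10 * \<epsilon> * R powr (real c + 3 - x)"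
           "\<bar>A2 * \<theta> + B2 * y + C2\<bar> \<le> 10 * \<epsilon> * R powr (real c + 3 - x)"
  defines "q \<equiv> \<bar>A1 * B2 - A2 * B1\<bar>"
  shows "q = 0 \<Longrightarrow> \<bar>B1 * C2 - B2 * C1\<bar> < 1"
    and "0 < q \<Longrightarrow> \<bar>(A1 * B2 - A2 * B1) * \<theta> - (B1 * C2 - B2 * C1)\<bar> < \<epsilon> * q powr - i"
    and "0 < q \<Longrightarrow> \<bar>(A1 * B2 - A2 * B1) * y - (C1 * A2 - C2 * A1)\<bar> < \<epsilon> * q powr - j"
    and "q powr (1 + j) < R powr (real n - real c - 2)"
proof -
  define L where "L = 1 / j"
  have jL: "j * L = 1" using j by (simp add: L_def)
  have L: "1 \<le> L" using inv_j_ge_1 by (simp add: L_def)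
  have uL: "u = (real c + 5 + L) * L" by (simp add: u L_def)
  have uj: "u * j = real c + 5 + L" by (simp add: uL mult.assoc jL mult.commute[of L])
  have u_ge: "real c + 5 + L \<le> u" 
    using mult_left_mono[OF L, of "real c + 5 + L"] L by (simp add: uL)
  define Q where "Q = x + L - u"
  note near = intersection_near[OF A B E, folded L_def]
  have i': "i = 1 - j" using ij by simp
  have ab: "R powr ((x + L) * i) * R powr ((x + L) * j - u) = R powr Q"
    by (simp add: powr_add[symmetric] Q_def i' algebra_simps)
  have q: "q \<le> 2 * R powr Q" using near(1) by (simp add: q_def ab mult.assoc)
  have q_nonneg: "0 \<le> q" by (simp add: q_def)
  have q_powr: "q powr e \<le> 2 * R powr (Q * e)" if e: "0 \<le> e" "e \<le> 1" for e
  proof -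
    have "q powr e \<le> (2 * R powr Q) powr e" using q q_nonneg e by (intro powr_mono2) auto
    also have "\<dots> = 2 powr e * R powr (Q * e)" by (simp add: powr_mult powr_powr)
    also have "\<dots> \<le> 2 powr 1 * R powr (Q * e)" using e by (intro mult_right_mono powr_mono) auto
    finally show ?thesis by simp
  qed
  \<comment> \<open>The bound \<open>8 \<le> R\<close> enters here: the products below cost a factor \<open>40 < R ^ 2\<close>.\<close>
  have Rm2: "R powr - 2 \<le> 1 / 64"
  proof -
    have "8 ^ 2 \<le> R ^ 2" using R by (intro power_mono) auto
    then have "1 / R ^ 2 \<le> 1 / 64" using R by (intro divide_left_mono) auto
    moreover have "R powr - 2 = 1 / R ^ 2" using R powr_realpow[of R 2] by (simp add: powr_minus divide_inverse)
    ultimately show ?thesis by simp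
  qed
  have close: "d < \<epsilon> * q powr - e"
    if "0 < q" "0 \<le> e" "e \<le> 1" "d \<le> 2 * R powr f * (10 * \<epsilon> * R powr (real c + 3 - x))"
      "f + (real c + 3 - x) + Q * e \<le> - 2" for d e f
  proof -
    have "d * q powr e \<le> 2 * R powr f * (10 * \<epsilon> * R powr (real c + 3 - x)) * (2 * R powr (Q * e))"
      using that q_powr \<epsilon> by (intro order_trans[OF mult_right_mono mult_left_mono]) auto
    also have "\<dots> = 40 * \<epsilon> * R powr (f + (real c + 3 - x) + Q * e)" by (simp add: powr_add)
    also have "\<dots> \<le> 40 * \<epsilon> * R powr - 2" using that \<epsilon> R by (intro mult_left_mono powr_mono) auto
    also have "\<dots> \<le> 40 * \<epsilon> * (1 / 64)" using Rm2 \<epsilon> by (intro mult_left_mono) auto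
    also have "\<dots> < \<epsilon>" using \<epsilon> by simp
    finally show ?thesis using that(1) by (simp add: powr_minus field_simps)
  qed
  have fb: "(x + L) * j - u + (real c + 3 - x) = 4 + real c - u - x * i"
    using jL by (simp add: i' algebra_simps)
  have fb_le: "4 + real c - u - x * i \<le> -2"
    using u_ge L x i mult_nonneg_nonneg[of x i] by linarith
  have "(x + L) * j - u + (real c + 3 - x) + Q * i = L + real c + 3 - u - u * i"
    using jL by (simp add: i' Q_def algebra_simps)
  also have "\<dots> \<le> - 2"
    using u_ge L i mult_nonneg_nonneg[of u i] by linarith
  finally have f1: "(x + L) * j - u + (real c + 3 - x) + Q * i \<le> - 2" .
  have f2: "(x + L) * i + (real c + 3 - x) + Q * j = - 2"
    using jL uj by (simp add: i' Q_def algebra_simps)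
  show "\<bar>(A1 * B2 - A2 * B1) * \<theta> - (B1 * C2 - B2 * C1)\<bar> < \<epsilon> * q powr - i" if "0 < q"
    using that i j ij f1 near(2) by (intro close) auto
  show "\<bar>(A1 * B2 - A2 * B1) * y - (C1 * A2 - C2 * A1)\<bar> < \<epsilon> * q powr - j" if "0 < q"
    using that i j ij f2 near(3) by (intro close) auto
  show "\<bar>B1 * C2 - B2 * C1\<bar> < 1" if "q = 0"
  proof -
    have "A1 * B2 - A2 * B1 = 0" using that by (simp add: q_def)
    from near(2)[unfolded this] have "\<bar>B1 * C2 - B2 * C1\<bar> \<le>
        2 * R powr ((x + L) * j - u) * (10 * \<epsilon> * R powr (real c + 3 - x))" by simp
    also have "\<dots> = 20 * \<epsilon> * R powr (4 + real c - u - x * i)"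
      unfolding fb[symmetric] powr_add by simp
    finally have "\<bar>B1 * C2 - B2 * C1\<bar> \<le> 20 * \<epsilon> * R powr (4 + real c - u - x * i)" .
    also have "20 * \<epsilon> * R powr (4 + real c - u - x * i) \<le> 20 * \<epsilon> * R powr 0"
      using fb_le \<epsilon> R by (intro mult_left_mono powr_mono) auto
    also have "\<dots> < 1" using \<epsilon>_lt \<epsilon> R by simp
    finally show ?thesis .
  qed
  have "q powr (1 + j) \<le> (2 * R powr Q) powr (1 + j)" using q q_nonneg j by (intro powr_mono2) auto
  also have "\<dots> = 2 powr (1 + j) * R powr (Q * (1 + j))" by (simp add: powr_mult powr_powr)
  also have "Q * (1 + j) = real n - real c - 4"
    using xu jL uj by (simp add: Q_def algebra_simps)
  also have "2 powr (1 + j) * R powr (real n - real c - 4) \<le> 2 powr 2 * R powr (real n - real c - 4)"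
    using j_le_1 by (intro mult_right_mono powr_mono) auto
  also have "R powr (real n - real c - 4) = R powr (real n - real c - 2) * R powr - 2"
    by (simp add: powr_add[symmetric])
  also have "2 powr 2 * (R powr (real n - real c - 2) * R powr - 2) \<le> 2 powr 2 * (R powr (real n - real c - 2) * (1 / 64))"
    using Rm2 by (intro mult_left_mono) auto
  also have "\<dots> < R powr (real n - real c - 2)" using R by simp
  finally show "q powr (1 + j) < R powr (real n - real c - 2)" .
qed


lemma incident_same_line_close:
  assumes P1: "incident p1 r1 q1 A1 B1 C1" "\<bar>of_int q1 * y1 - of_int r1\<bar> < \<epsilon> * of_int q1 powr - j"
    "R ^ n \<le> of_int q1 * of_int B1"
   and P2: "incident p2 r2 q2 A2 B2 C2" "\<bar>of_int q2 * y2 - of_int r2\<bar> < \<epsilon> * of_int q2 powr - j"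
    "R ^ n \<le> of_int q2 * of_int B2"
   and "A1 * B2 = A2 * B1" "B1 * C2 = B2 * C1"
 shows "\<bar>y1 - y2\<bar> \<le> 4 * \<epsilon> / R ^ n"
proof -
  have "\<bar>y1 - y2\<bar> \<le> 2 * (2 * \<epsilon>) / R ^ n"
  proof (rule close_on_same_line)
    show "real_of_int A1 * of_int B2 = of_int A2 * of_int B1" "real_of_int B1 * of_int C2 = of_int B2 * of_int C1"
      using assms(7,8) by (metis of_int_mult)+
    show "\<bar>of_int A1 * \<theta> + of_int B1 * y1 + of_int C1\<bar> \<le> 2 * \<epsilon> / of_int q1"
      using P1 by (intro incident_line_value)
    show "\<bar>of_int A2 * \<theta> + of_int B2 * y2 + of_int C2\<bar> \<le> 2 * \<epsilon> / of_int q2"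
      using P2 by (intro incident_line_value)
  qed (use P1 P2 R \<epsilon> in \<open>auto simp: incident_def\<close>)
  then show ?thesis by simp
qed

lemma incident_height:
  assumes "incident p r q A B C"
  shows "of_int q * of_int B \<le> real_of_int q powr (1 + j)"
  using assms by (auto simp: incident_def powr_add)

text \<open>
For a line that belongs to a point \<open>y'\<close>, evaluated at a nearby \<open>y\<close>: the displacement
contributes \<open>B \<bar>y - y'\<bar>\<close>, which dominates.
\<close>

lemma other_line_value:
  assumes P: "incident p r q A B C" "\<bar>of_int q * y' - of_int r\<bar> < \<epsilon> * of_int q powr - j"
    "of_int q * of_int B < R ^ Suc n"
    and d: "\<bar>y - y'\<bar> \<le> 8 * \<epsilon> * R ^ Suc c / R ^ n"
  shows "\<bar>of_int A * \<theta> + of_int B * y + of_int C\<bar> \<le> 10 * \<epsilon> * R ^ (c + 2) / of_int q"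
proof -
  have q: "0 < real_of_int q" "0 < real_of_int B" using P(1) by (auto simp: incident_def)
  have "of_int B * \<bar>y - y'\<bar> \<le> (R ^ Suc n / of_int q) * (8 * \<epsilon> * R ^ Suc c / R ^ n)"
    using P(3) d q \<epsilon> R by (intro mult_mono) (auto simp: field_simps)
  also have "\<dots> = 8 * \<epsilon> * R ^ (c + 2) / of_int q" using R q by (simp add: field_simps)
  finally have "of_int B * \<bar>y - y'\<bar> \<le> 8 * \<epsilon> * R ^ (c + 2) / of_int q" .
  moreover have "\<bar>of_int A * \<theta> + of_int B * y' + of_int C\<bar> \<le> 2 * \<epsilon> * R ^ (c + 2) / of_int q"
  proof -
    have "1 \<le> R ^ (c + 2)" using R by (intro one_le_power) auto
    then have "2 * \<epsilon> / of_int q \<le> 2 * \<epsilon> * R ^ (c + 2) / of_int q"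
      using q \<epsilon> by (intro divide_right_mono) auto
    with incident_line_value[OF P(1,2)] show ?thesis by linarith
  qed
  moreover have "\<bar>of_int A * \<theta> + of_int B * y + of_int C\<bar> \<le>
     \<bar>of_int A * \<theta> + of_int B * y' + of_int C\<bar> + of_int B * \<bar>y - y'\<bar>"
  proof -
    have "of_int A * \<theta> + of_int B * y + of_int C = (of_int A * \<theta> + of_int B * y' + of_int C) + of_int B * (y - y')"
      by (simp add: algebra_simps)
    then show ?thesis using q abs_triangle_ineq[of "of_int A * \<theta> + of_int B * y' + of_int C" "of_int B * (y - y')"]
      by (simp add: abs_mult)
  qed
  ultimately show ?thesis by (simp add: add_divide_distrib[symmetric] del: power_Suc)
qed

text \<open>
In class \<open>0\<close> all denominators of height \<open>n\<close> agree up to a constant factor \<open>G\<close>. The value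
of one linear form at the homogeneous coordinates of the other rational point is an
integer of absolute value less than \<open>1\<close>, so each of the two rational points lies on both
lines.
\<close>

lemma obstacle_pair_class_0:
  assumes y1: "y1 \<in> obstacle n 0" and y2: "y2 \<in> obstacle n 0"
    and d: "\<bar>y1 - y2\<bar> \<le> 8 * \<epsilon> * R / R ^ n"
  shows "\<bar>y1 - y2\<bar> \<le> 4 * \<epsilon> / R ^ n"
proof -
  define G where "G = R powr ((5 + 1 / j) / j + 1)"
  have data: "real_of_int q powr (1 + j) \<le> G * R ^ n" "R ^ n \<le> real_of_int q powr (1 + j)"
    if "incident p r q A B C" "R ^ n \<le> of_int q * of_int B" "of_int q * of_int B < R ^ Suc n"
      "of_int q powr j / of_int B < thr (Suc 0)" for p r q A B C
  proof -
    have q: "0 < real_of_int q" "0 < real_of_int B" using that(1) by (auto simp: incident_def)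
    have "real_of_int q powr (1 + j) = (of_int q powr j / of_int B) * (of_int q * of_int B)"
      using q by (simp add: powr_add)
    also have "\<dots> \<le> thr (Suc 0) * R ^ Suc n" using that(2-4) q R by (intro mult_mono) (auto simp: thr_def)
    also have "\<dots> = G * R ^ n" using R by (simp add: thr_def G_def powr_add)
    finally show "real_of_int q powr (1 + j) \<le> G * R ^ n" .
    show "R ^ n \<le> real_of_int q powr (1 + j)" using incident_height[OF that(1)] that(2) by simp
  qed
  have G: "1 \<le> G" unfolding G_def using R j by (intro ge_one_powr_ge_zero) auto
  have G_small: "12 * \<epsilon> * G * R ^ 2 < 1"
  proof -
    have "G * R ^ 2 = R powr ((5 + 1 / j) / j + 3)"
    proof -
      have "R ^ 2 = R powr 2" using R powr_realpow[of R 2] by simp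
      then show ?thesis unfolding G_def by (simp only: powr_add[symmetric]) (simp add: add.commute)
    qed
    with \<epsilon>_small show ?thesis by (simp add: mult.assoc)
  qed
  have on_line: "A * p + B * r + C * q = 0"
    if P: "incident p' r' q' A B C" "\<bar>of_int q' * z' - of_int r'\<bar> < \<epsilon> * of_int q' powr - j"
        "R ^ n \<le> of_int q' * of_int B" "of_int q' * of_int B < R ^ Suc n" "of_int q' powr j / of_int B < thr (Suc 0)"
     and Q: "incident p r q A' B' C'" "\<bar>of_int q * z - of_int r\<bar> < \<epsilon> * of_int q powr - j"
        "R ^ n \<le> of_int q * of_int B'" "of_int q * of_int B' < R ^ Suc n" "of_int q powr j / of_int B' < thr (Suc 0)"
     and z: "\<bar>z - z'\<bar> \<le> 8 * \<epsilon> * R ^ Suc 0 / R ^ n" for p r q A B C p' r' q' A' B' C' z z'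
  proof -
    have q: "0 < real_of_int q" "0 < real_of_int q'" using P(1) Q(1) by (auto simp: incident_def)
    have ratio: "x / y \<le> G" if "0 < x" "0 < y" "x powr (1 + j) \<le> G * R ^ n" "R ^ n \<le> y powr (1 + j)" for x y :: real
    proof -
      have "(x / y) powr (1 + j) = x powr (1 + j) / y powr (1 + j)" using that by (simp add: powr_divide)
      also have "\<dots> \<le> G * R ^ n / R ^ n" using that R G by (intro frac_le) auto
      also have "\<dots> = G powr 1" using R G by simp
      also have "\<dots> \<le> G powr (1 + j)" using G j by (intro powr_mono) auto
      finally have "(x / y) powr (1 + j) \<le> G powr (1 + j)" .
      with j G show ?thesis by (elim le_of_powr_le[rotated 2]) auto
    qed
    have qq: "of_int q / of_int q' \<le> G" "of_int q' / of_int q \<le> G"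
      using data[OF P(1,3,4,5)] data[OF Q(1,3,4,5)] q by (auto intro!: ratio)
    have pw: "(of_int q' :: real) powr e * of_int q powr - e \<le> G" if "0 \<le> e" "e \<le> 1" for e
    proof -
      have "(of_int q' :: real) powr e * of_int q powr - e = (of_int q' / of_int q) powr e"
        using q by (simp add: powr_divide powr_minus_divide)
      also have "\<dots> \<le> G powr e" using qq q that by (intro powr_mono2) auto
      also have "\<dots> \<le> G powr 1" using G that by (intro powr_mono) auto
      finally show ?thesis using G by simp
    qed
    define E where "E = of_int A * \<theta> + of_int B * z + of_int C"
    have E: "\<bar>E\<bar> \<le> 10 * \<epsilon> * R ^ 2 / of_int q'"
      using other_line_value[OF P(1,2,4), of z 0] z by (simp add: E_def power2_eq_square)
    have A: "\<bar>real_of_int A\<bar> \<le> of_int q' powr i" "\<bar>real_of_int B\<bar> \<le> of_int q' powr j"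
      and p: "\<bar>of_int q * \<theta> - of_int p\<bar> \<le> \<epsilon> * of_int q powr - i"
      using P(1) Q(1) by (auto simp: incident_def)
    have "real_of_int (A * p + B * r + C * q) =
       of_int q * E - of_int A * (of_int q * \<theta> - of_int p) - of_int B * (of_int q * z - of_int r)"
      by (simp add: E_def algebra_simps)
    then have "\<bar>real_of_int (A * p + B * r + C * q)\<bar> \<le>
       \<bar>of_int q * E\<bar> + \<bar>of_int A * (of_int q * \<theta> - of_int p)\<bar> + \<bar>of_int B * (of_int q * z - of_int r)\<bar>"
      by linarith
    also have "\<dots> \<le> 10 * \<epsilon> * R ^ 2 * G + \<epsilon> * G + \<epsilon> * G"
    proof (intro add_mono)
      have "\<bar>of_int q * E\<bar> \<le> of_int q * (10 * \<epsilon> * R ^ 2 / of_int q')"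
        using mult_left_mono[OF E, of "of_int q"] q by (simp add: abs_mult)
      also have "\<dots> = 10 * \<epsilon> * R ^ 2 * (of_int q / of_int q')" by simp
      also have "\<dots> \<le> 10 * \<epsilon> * R ^ 2 * G" using qq \<epsilon> by (intro mult_left_mono) auto
      finally show "\<bar>of_int q * E\<bar> \<le> 10 * \<epsilon> * R ^ 2 * G" .
      have "\<bar>of_int A * (of_int q * \<theta> - of_int p)\<bar> \<le> of_int q' powr i * (\<epsilon> * of_int q powr - i)"
        unfolding abs_mult using A p by (intro mult_mono) auto
      also have "\<dots> = \<epsilon> * (of_int q' powr i * of_int q powr - i)" by simp
      also have "\<dots> \<le> \<epsilon> * G" using pw[of i] i j ij \<epsilon> by (intro mult_left_mono) auto
      finally show "\<bar>of_int A * (of_int q * \<theta> - of_int p)\<bar> \<le> \<epsilon> * G" .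
      have "\<bar>of_int B * (of_int q * z - of_int r)\<bar> \<le> of_int q' powr j * (\<epsilon> * of_int q powr - j)"
        unfolding abs_mult using A Q(2) by (intro mult_mono) auto
      also have "\<dots> = \<epsilon> * (of_int q' powr j * of_int q powr - j)" by simp
      also have "\<dots> \<le> \<epsilon> * G" using pw[of j] j j_le_1 \<epsilon> by (intro mult_left_mono) auto
      finally show "\<bar>of_int B * (of_int q * z - of_int r)\<bar> \<le> \<epsilon> * G" .
    qed
    also have "\<dots> \<le> 12 * \<epsilon> * G * R ^ 2"
    proof -
      have "1 \<le> R ^ 2" using R by (intro one_le_power) auto
      then have "\<epsilon> * G * 1 \<le> \<epsilon> * G * R ^ 2" using \<epsilon> G by (intro mult_left_mono) auto
      then show ?thesis by (simp add: algebra_simps)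
    qed
    also note G_small
    finally show ?thesis by (rule int_abs_less_one)
  qed
  obtain p1 r1 q1 A1 B1 C1 where P1: "incident p1 r1 q1 A1 B1 C1"
    "\<bar>of_int q1 * y1 - of_int r1\<bar> < \<epsilon> * of_int q1 powr - j"
    "R ^ n \<le> of_int q1 * of_int B1" "of_int q1 * of_int B1 < R ^ Suc n" "of_int q1 powr j / of_int B1 < thr (Suc 0)"
    using y1 unfolding obstacle_def by blast
  obtain p2 r2 q2 A2 B2 C2 where P2: "incident p2 r2 q2 A2 B2 C2"
    "\<bar>of_int q2 * y2 - of_int r2\<bar> < \<epsilon> * of_int q2 powr - j"
    "R ^ n \<le> of_int q2 * of_int B2" "of_int q2 * of_int B2 < R ^ Suc n" "of_int q2 powr j / of_int B2 < thr (Suc 0)"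
    using y2 unfolding obstacle_def by blast
  have q: "0 < q1" "0 < q2" using P1(1) P2(1) by (auto simp: incident_def)
  have "A1 * p1 + B1 * r1 + C1 * q1 = 0" "A2 * p2 + B2 * r2 + C2 * q2 = 0"
    using P1(1) P2(1) by (auto simp: incident_def)
  moreover have "A1 * p2 + B1 * r2 + C1 * q2 = 0" "A2 * p1 + B2 * r1 + C2 * q1 = 0"
    using d by (auto intro!: on_line[OF P1 P2] on_line[OF P2 P1] simp: abs_minus_commute)
  ultimately consider "A1 * B2 = A2 * B1" "B1 * C2 = B2 * C1" | "r1 * q2 = r2 * q1"
    using parallel_or_same_point[of A1 p1 B1 r1 C1 q1 A2 B2 C2 p2 r2 q2] q by blast
  then show ?thesis
  proof cases
    case 1
    then show ?thesis using P1 P2 by (intro incident_same_line_close)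
  next
    case 2
    then have "real_of_int r1 * of_int q2 = of_int r2 * of_int q1" by (metis of_int_mult)
    then have eq: "real_of_int r1 / of_int q1 = of_int r2 / of_int q2" using q by (simp add: field_simps)
    have near: "\<bar>y - of_int r / of_int q\<bar> \<le> \<epsilon> / R ^ n"
      if "0 < q" "\<bar>of_int q * y - of_int r\<bar> < \<epsilon> * of_int q powr - j" "R ^ n \<le> of_int q powr (1 + j)" for y and q r :: int
    proof -
      have "of_int q * \<bar>y - of_int r / of_int q\<bar> = \<bar>of_int q * y - of_int r\<bar>"
        using that(1) by (simp add: abs_mult_pos' right_diff_distrib)
      then have "\<bar>y - of_int r / of_int q\<bar> \<le> \<epsilon> / of_int q powr (1 + j)"
        using that(1,2) by (simp add: powr_add powr_minus field_simps)
      also have "\<dots> \<le> \<epsilon> / R ^ n" using that \<epsilon> R by (intro divide_left_mono) auto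
      finally show ?thesis .
    qed
    have "\<bar>y1 - of_int r1 / of_int q1\<bar> \<le> \<epsilon> / R ^ n" "\<bar>y2 - of_int r2 / of_int q2\<bar> \<le> \<epsilon> / R ^ n"
      using near[OF q(1) P1(2) data(2)[OF P1(1,3,4,5)]] near[OF q(2) P2(2) data(2)[OF P2(1,3,4,5)]] .
    with eq have "\<bar>y1 - y2\<bar> \<le> \<epsilon> / R ^ n + \<epsilon> / R ^ n" by linarith
    also have "\<dots> \<le> 4 * \<epsilon> / R ^ n" using \<epsilon> R by (simp add: field_simps)
    finally show ?thesis .
  qed
qed

lemma obstacle_pair_class_Suc:
  assumes y1: "y1 \<in> obstacle n (Suc c)" and y2: "y2 \<in> obstacle n (Suc c)"
    and d: "\<bar>y1 - y2\<bar> \<le> 8 * \<epsilon> * R ^ Suc (Suc c) / R ^ n"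
  shows "\<bar>y1 - y2\<bar> \<le> 4 * \<epsilon> / R ^ n \<or> (\<exists>n' c'. n' + Suc c + 1 \<le> n \<and> y1 \<in> obstacle n' c')"
proof -
  obtain p1 r1 q1 A1 B1 C1 where P1: "incident p1 r1 q1 A1 B1 C1"
    "\<bar>of_int q1 * y1 - of_int r1\<bar> < \<epsilon> * of_int q1 powr - j"
    "R ^ n \<le> of_int q1 * of_int B1" "of_int q1 * of_int B1 < R ^ Suc n"
    "thr (Suc c) \<le> of_int q1 powr j / of_int B1" "of_int q1 powr j / of_int B1 < thr (Suc (Suc c))"
    using y1 unfolding obstacle_def by blast
  obtain p2 r2 q2 A2 B2 C2 where P2: "incident p2 r2 q2 A2 B2 C2"
    "\<bar>of_int q2 * y2 - of_int r2\<bar> < \<epsilon> * of_int q2 powr - j"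
    "R ^ n \<le> of_int q2 * of_int B2" "of_int q2 * of_int B2 < R ^ Suc n"
    "thr (Suc c) \<le> of_int q2 powr j / of_int B2" "of_int q2 powr j / of_int B2 < thr (Suc (Suc c))"
    using y2 unfolding obstacle_def by blast
  define u where "u = (real c + 5 + 1 / j) / j"
  define x where "x = (u + n) / (1 + j)"
  have u: "0 \<le> u" using j by (simp add: u_def)
  have x: "0 \<le> x" "x * (1 + j) = u + n" using j u by (simp_all add: x_def)
  have bounds: "\<bar>real_of_int A\<bar> \<le> R powr ((x + 1 / j) * i)" "\<bar>real_of_int B\<bar> \<le> R powr ((x + 1 / j) * j - u)"
       "\<bar>of_int A * \<theta> + of_int B * y + of_int C\<bar> \<le> 10 * \<epsilon> * R powr (real c + 3 - x)"
    if P: "incident p r q A B C" "\<bar>of_int q * y' - of_int r\<bar> < \<epsilon> * of_int q powr - j"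
    "R ^ n \<le> of_int q * of_int B" "of_int q * of_int B < R ^ Suc n"
    "thr (Suc c) \<le> of_int q powr j / of_int B" "of_int q powr j / of_int B < thr (Suc (Suc c))"
    "\<bar>y - y'\<bar> \<le> 8 * \<epsilon> * R ^ Suc (Suc c) / R ^ n" for p r q A B C y y'
  proof -
    have q: "1 \<le> real_of_int q" "1 \<le> real_of_int B" using P(1) by (auto simp: incident_def)
    note w = height_window[OF q P(3-6) u_def x_def]
    show "\<bar>real_of_int B\<bar> \<le> R powr ((x + 1 / j) * j - u)" using w(3) q by simp
    have "\<bar>real_of_int A\<bar> \<le> of_int q powr i" using P(1) by (simp add: incident_def)
    also have "\<dots> \<le> (R powr (x + 1 / j)) powr i" using w(2) q i by (intro powr_mono2) auto
    finally show "\<bar>real_of_int A\<bar> \<le> R powr ((x + 1 / j) * i)" by (simp add: powr_powr)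
    have "\<bar>of_int A * \<theta> + of_int B * y + of_int C\<bar> \<le> 10 * \<epsilon> * R ^ (Suc c + 2) / of_int q"
      by (rule other_line_value[OF P(1,2,4,7)])
    also have "\<dots> \<le> 10 * \<epsilon> * R ^ (Suc c + 2) / R powr x"
      using w(1) \<epsilon> R q by (intro divide_left_mono) auto
    also have "R ^ (Suc c + 2) = R powr (real c + 3)"
      using R powr_realpow[of R "Suc c + 2"] by (simp add: add_ac)
    also have "10 * \<epsilon> * R powr (real c + 3) / R powr x = 10 * \<epsilon> * R powr (real c + 3 - x)"
      by (simp add: powr_diff)
    finally show "\<bar>of_int A * \<theta> + of_int B * y + of_int C\<bar> \<le> 10 * \<epsilon> * R powr (real c + 3 - x)" .
  qed
  have d0: "\<bar>y1 - y1\<bar> \<le> 8 * \<epsilon> * R ^ Suc (Suc c) / R ^ n" using \<epsilon> R by simp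
  note b1 = bounds[OF P1 d0] and b2 = bounds[OF P2 d]
  define D where "D = A1 * B2 - A2 * B1"
  define p0 where "p0 = B1 * C2 - B2 * C1"
  define r0 where "r0 = C1 * A2 - C2 * A1"
  have inter: "real_of_int \<bar>D\<bar> = 0 \<Longrightarrow> \<bar>real_of_int p0\<bar> < 1"
    "0 < real_of_int \<bar>D\<bar> \<Longrightarrow> \<bar>of_int D * \<theta> - of_int p0\<bar> < \<epsilon> * of_int \<bar>D\<bar> powr - i"
    "0 < real_of_int \<bar>D\<bar> \<Longrightarrow> \<bar>of_int D * y1 - of_int r0\<bar> < \<epsilon> * of_int \<bar>D\<bar> powr - j"
    "real_of_int \<bar>D\<bar> powr (1 + j) < R powr (real n - real c - 2)"
    using intersection_is_dangerous[OF x(1) u_def x(2) b1(1) b2(1) b1(2) b2(2) b1(3) b2(3)]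
    by (simp_all add: D_def p0_def r0_def)
  show ?thesis
  proof (cases "D = 0")
    case True
    then have "p0 = 0" using inter(1) by (intro int_abs_less_one) simp
    with True have "A1 * B2 = A2 * B1" "B1 * C2 = B2 * C1" by (simp_all add: D_def p0_def)
    then show ?thesis using P1 P2 by (intro disjI1 incident_same_line_close)
  next
    case False
    \<comment> \<open>The intersection has homogeneous coordinates \<open>(p0, r0, D)\<close>; the sign makes the denominator positive.\<close>
    define q where "q = \<bar>D\<bar>"
    define p where "p = sgn D * p0"
    define r where "r = sgn D * r0"
    have q: "0 < q" using False by (simp add: q_def)
    have sgn: "\<bar>of_int q * z - of_int (sgn D * w)\<bar> = \<bar>of_int D * z - of_int w\<bar>" for z :: real and w
      using False by (cases "D > 0") (auto simp: q_def abs_if)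
    have close: "\<bar>of_int q * \<theta> - of_int p\<bar> < \<epsilon> * of_int q powr - i" "\<bar>of_int q * y1 - of_int r\<bar> < \<epsilon> * of_int q powr - j"
      using inter(2,3) q unfolding p_def r_def sgn by (simp_all add: q_def)
    obtain A B C where line: "incident p r q A B C"
      using line_exists[OF q close(1), of r] q close(1) unfolding incident_def by blast
    obtain n' c' where n': "y1 \<in> obstacle n' c'" "R ^ n' \<le> of_int q * of_int B"
      using obstacle_cover[OF line close(2)] .
    have "R powr n' = R ^ n'" using R by (simp add: powr_realpow)
    also have "\<dots> \<le> of_int q powr (1 + j)" using n'(2) incident_height[OF line] by linarith
    also have "\<dots> < R powr (real n - real c - 2)" using inter(4) by (simp add: q_def)
    finally have "real n' < real n - real c - 2" using R by simp
    then have "n' + Suc c + 1 \<le> n" by linarith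
    with n'(1) show ?thesis by blast
  qed
qed

text \<open>
Both cases together, in the form in which the potential argument uses them: inside an
interval of length of order \<open>\<epsilon> R ^ (c + 1) / R ^ n\<close> that avoids the obstacles of height
less than \<open>R ^ (n - c - 1)\<close>, the obstacle \<open>(n, c)\<close> has diameter at most \<open>4 \<epsilon> / R ^ n\<close>.
\<close>

lemma obstacle_pair:
  assumes "y1 \<in> obstacle n c" "y2 \<in> obstacle n c"
    and "\<bar>y1 - y2\<bar> \<le> 8 * \<epsilon> * R ^ Suc c / R ^ n"
  shows "\<bar>y1 - y2\<bar> \<le> 4 * \<epsilon> / R ^ n \<or> (\<exists>n' c'. n' + c + 1 \<le> n \<and> y1 \<in> obstacle n' c')"
  using assms obstacle_pair_class_0[of y1 n y2] obstacle_pair_class_Suc[of y1 n _ y2] 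
  by (cases c) auto

lemma avoiding_obstacles:
  assumes y: "\<And>n c. y \<notin> obstacle n c" and q: "0 < q"
  shows "\<epsilon> * of_int q powr - i \<le> \<bar>of_int q * \<theta> - of_int p\<bar> \<or> \<epsilon> * of_int q powr - j \<le> \<bar>of_int q * y - of_int r\<bar>"
proof (rule ccontr)
  assume "\<not> ?thesis"
  then have close: "\<bar>of_int q * \<theta> - of_int p\<bar> < \<epsilon> * of_int q powr - i" "\<bar>of_int q * y - of_int r\<bar> < \<epsilon> * of_int q powr - j"
    by auto
  obtain A B C where "incident p r q A B C"
    using line_exists[OF q close(1), of r] q close(1) unfolding incident_def by blast
  from obstacle_cover[OF this close(2)] y show False by blast
qed

end

section \<open>Lines through rational points near the fibre\<close>

text \<open>
Pigeonhole: there are more than \<open>q\<^sup>i q\<^sup>j = q\<close> pairs \<open>(a, b)\<close> of integers in the box, so two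
of the residues of \<open>a p + b r\<close> modulo \<open>q\<close> coincide.
\<close>

lemma small_integer_relation:
  fixes p r q :: int and i j :: real
  assumes q: "0 < q" and ij: "0 \<le> i" "0 \<le> j" "i + j = 1"
  shows "\<exists>A B C :: int. (A \<noteq> 0 \<or> B \<noteq> 0) \<and> A * p + B * r + C * q = 0 \<and>
     \<bar>of_int A\<bar> \<le> of_int q powr i \<and> \<bar>of_int B\<bar> \<le> of_int q powr j"
proof -
  define K where "K e = \<lfloor>real_of_int q powr e\<rfloor>" for e
  have K: "0 \<le> K e" "real_of_int q powr e < of_int (K e + 1)" for e
    by (auto simp: K_def)
  define S where "S = {0..K i} \<times> {0..K j}"
  define h where "h = (\<lambda>(a, b). (a * p + b * r) mod q)"
  have "of_int q = real_of_int q powr i * real_of_int q powr j"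
    using q ij by (simp add: powr_add[symmetric])
  also have "\<dots> < of_int (K i + 1) * of_int (K j + 1)"
    using K(2) q by (intro mult_strict_mono') auto
  finally have "q < (K i + 1) * (K j + 1)" by (metis of_int_less_iff of_int_mult)
  moreover have "int (card S) = (K i + 1) * (K j + 1)"
    using K(1)[of i] K(1)[of j] by (simp add: S_def card_cartesian_product)
  ultimately have card: "card S > card {0..<q}" using q by simp
  have "h ` S \<subseteq> {0..<q}" using q by (auto simp: h_def)
  then have "\<not> inj_on h S" using card by (metis card_inj_on_le finite_atLeastLessThan_int not_le)
  then obtain a b a' b' where s: "(a, b) \<in> S" "(a', b') \<in> S" "(a, b) \<noteq> (a', b')" "h (a, b) = h (a', b')"
    unfolding inj_on_def by auto
  have "q dvd (a * p + b * r) - (a' * p + b' * r)"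
    using s(4) by (simp add: h_def mod_eq_dvd_iff)
  then obtain C where "(a * p + b * r) - (a' * p + b' * r) = q * C" by (rule dvdE)
  then have "(a - a') * p + (b - b') * r + (- C) * q = 0" by (simp add: algebra_simps)
  moreover have le: "\<bar>of_int z\<bar> \<le> real_of_int q powr e" if "\<bar>z\<bar> \<le> K e" for z e
    using that unfolding K_def le_floor_iff by simp
  have "\<bar>of_int (a - a')\<bar> \<le> real_of_int q powr i" "\<bar>of_int (b - b')\<bar> \<le> real_of_int q powr j"
    using s(1,2) by (intro le; auto simp: S_def)+
  moreover have "a - a' \<noteq> 0 \<or> b - b' \<noteq> 0" using s(3) by auto
  ultimately show ?thesis by blast
qed

text \<open>
A vertical line \<open>A x + C = 0\<close> through the rational point would give the approximation
\<open>- C / A\<close> of \<open>\<theta>\<close>, and \<open>\<bar>A\<bar> \<le> q\<^sup>i\<close> makes it better than a number that is badly approximable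
with exponent \<open>1 / i\<close> permits.
\<close>

lemma bad_abscissa_non_vertical_line:
  fixes p r q :: int and i j \<theta> \<epsilon> c :: real
  assumes ij: "0 < i" "0 \<le> j" "i + j = 1"
    and bad: "\<And>(p::int) (q::nat). q \<ge> 1 \<Longrightarrow> real q powr (1 / i) * \<bar>real q * \<theta> - of_int p\<bar> > c"
    and \<epsilon>: "0 < \<epsilon>" "\<epsilon> \<le> c" 
    and q: "0 < q" and near: "\<bar>of_int q * \<theta> - of_int p\<bar> < \<epsilon> * of_int q powr - i"
  shows "\<exists>A B C :: int. 0 < B \<and> A * p + B * r + C * q = 0 \<and>
        \<bar>of_int A\<bar> \<le> of_int q powr i \<and> of_int B \<le> of_int q powr j"
proof -
  obtain A B C where L: "A \<noteq> 0 \<or> B \<noteq> 0" "A * p + B * r + C * q = 0"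
    "\<bar>of_int A\<bar> \<le> real_of_int q powr i" "\<bar>of_int B\<bar> \<le> real_of_int q powr j"
    using small_integer_relation[OF q _ ij(2,3), of p r] ij(1) by auto
  have "B \<noteq> 0"
  proof
    assume B: "B = 0"
    then have A: "A \<noteq> 0" and AC: "A * p = - C * q" using L by auto
    define a where "a = nat \<bar>A\<bar>"
    have a: "1 \<le> a" "real a = \<bar>of_int A\<bar>" using A by (auto simp: a_def)
    have "of_int A * (of_int p :: real) = - of_int C * of_int q"
      using AC by (metis of_int_mult of_int_minus)
    then have "of_int q * (of_int A * \<theta> + of_int C) = of_int A * (of_int q * \<theta> - of_int p)"
      by (simp add: algebra_simps)
    then have eq: "of_int q * \<bar>of_int A * \<theta> + of_int C\<bar> = real a * \<bar>of_int q * \<theta> - of_int p\<bar>"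
      using q by (metis a(2) abs_mult abs_of_pos of_int_0_less_iff)
    have "c < real a powr (1 / i) * \<bar>real a * \<theta> - of_int (- (sgn A) * C)\<bar>"
      using a(1) by (rule bad)
    also have "\<bar>real a * \<theta> - of_int (- (sgn A) * C)\<bar> = \<bar>of_int A * \<theta> + of_int C\<bar>"
    proof -
      have "real a * \<theta> - of_int (- (sgn A) * C) = of_int (sgn A) * (of_int A * \<theta> + of_int C)"
        using A by (cases "A > 0") (auto simp: a(2) algebra_simps)
      then show ?thesis using A by (simp add: abs_mult flip: of_int_abs)
    qed
    also have "real a powr (1 / i) * \<bar>of_int A * \<theta> + of_int C\<bar> \<le> of_int q * \<bar>of_int A * \<theta> + of_int C\<bar>"
    proof (intro mult_right_mono)
      have "real a powr (1 / i) \<le> (of_int q powr i) powr (1 / i)"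
        using L(3) a ij by (intro powr_mono2) auto
      then show "real a powr (1 / i) \<le> of_int q" using ij q by (simp add: powr_powr)
    qed auto
    also have "\<dots> \<le> of_int q powr i * (\<epsilon> * of_int q powr - i)"
      unfolding eq using near L(3) a by (intro mult_mono) auto
    also have "\<dots> = \<epsilon>" using q by (simp add: powr_minus field_simps)
    finally show False using \<epsilon> by simp
  qed
  define \<sigma> where "\<sigma> = sgn B"
  have "0 < \<sigma> * B" using \<open>B \<noteq> 0\<close> by (simp add: \<sigma>_def sgn_if)
  moreover have "(\<sigma> * A) * p + (\<sigma> * B) * r + (\<sigma> * C) * q = 0"
    using L(2) by (metis distrib_left mult.assoc mult_zero_right)
  moreover have "\<bar>real_of_int (\<sigma> * A)\<bar> = \<bar>of_int A\<bar>" "real_of_int (\<sigma> * B) = \<bar>of_int B\<bar>"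
    using \<open>B \<noteq> 0\<close> by (auto simp: \<sigma>_def sgn_if)
  ultimately show ?thesis using L(3,4) by metis
qed

section \<open>Fibres of the sets of badly approximable vectors\<close>

text \<open>
What the potential argument needs to know about the obstacles of one pair of weights: they
cover the complement of \<open>Y\<close>, and the diameter property of \<open>obstacle_pair\<close> holds with \<open>\<kappa>\<close>
in place of \<open>4 \<epsilon>\<close>.
\<close>

definition obstacle_family :: "real \<Rightarrow> real \<Rightarrow> real set \<Rightarrow> (nat \<Rightarrow> nat \<Rightarrow> real set) \<Rightarrow> bool" where
  "obstacle_family R \<kappa> Y D \<longleftrightarrow>
     (\<forall>n c. open (D n c)) \<and> (\<forall>n c. n < c \<longrightarrow> D n c = {}) \<and>
     (\<forall>n c y z. y \<in> D n c \<longrightarrow> z \<in> D n c \<longrightarrow> \<bar>y - z\<bar> \<le> 2 * \<kappa> * R ^ Suc c / R ^ n \<longrightarrow>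
        \<bar>y - z\<bar> \<le> \<kappa> / R ^ n \<or> (\<exists>n' c'. n' + c + 1 \<le> n \<and> y \<in> D n' c')) \<and>
     (\<forall>y. (\<forall>n c. y \<notin> D n c) \<longrightarrow> y \<in> Y)"

lemma obstacle_family_covers:
  assumes "obstacle_family R \<kappa> Y D" "\<And>n c. y \<notin> D n c"
  shows "y \<in> Y"
  using assms unfolding obstacle_family_def by auto

lemma (in weighted_line_system) obstacle_family_obstacle:
  assumes "\<And>y. (\<And>p r q :: int. 0 < q \<Longrightarrow> \<epsilon> * of_int q powr - i \<le> \<bar>of_int q * \<theta> - of_int p\<bar> \<or>
     \<epsilon> * of_int q powr - j \<le> \<bar>of_int q * y - of_int r\<bar>) \<Longrightarrow> y \<in> Y"
  shows "obstacle_family R (4 * \<epsilon>) Y obstacle"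
  unfolding obstacle_family_def
  using open_obstacle obstacle_empty obstacle_pair avoiding_obstacles assms by (auto simp: mult.assoc)

lemma Bad_member:
  fixes i j \<epsilon> :: real
  assumes ij: "0 < i" "0 < j" and \<epsilon>: "0 < \<epsilon>"
    and far: "\<And>p r q :: int. 0 < q \<Longrightarrow> \<epsilon> * of_int q powr - i \<le> \<bar>of_int q * x - of_int p\<bar> \<or>
     \<epsilon> * of_int q powr - j \<le> \<bar>of_int q * y - of_int r\<bar>"
  shows "(x, y) \<in> Bad i j"
proof -
  obtain c where c: "0 < c" "c < \<epsilon> powr (1 / i)" "c < \<epsilon> powr (1 / j)"
    using \<epsilon> dense[of 0 "min (\<epsilon> powr (1 / i)) (\<epsilon> powr (1 / j))"] by auto
  have one: "c < q * d powr (1 / e)" if "0 < e" "0 < q" "c < \<epsilon> powr (1 / e)" "\<epsilon> * q powr - e \<le> d" for e q d :: real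
  proof -
    have "(\<epsilon> * q powr - e) powr (1 / e) = \<epsilon> powr (1 / e) * q powr - 1"
      using that(1) by (simp add: powr_mult powr_powr)
    then have "q * (\<epsilon> * q powr - e) powr (1 / e) = \<epsilon> powr (1 / e)"
      using that(2) by (simp add: powr_minus_divide)
    with that(3) have "c < q * (\<epsilon> * q powr - e) powr (1 / e)" by linarith
    also have "\<dots> \<le> q * d powr (1 / e)" using that \<epsilon> by (intro mult_left_mono powr_mono2) auto
    finally show ?thesis .
  qed
  have "c < max (real q * \<bar>real q * x - of_int p1\<bar> powr (1 / i)) (real q * \<bar>real q * y - of_int p2\<bar> powr (1 / j))"
    if "1 \<le> q" for p1 p2 :: int and q :: nat
    using far[of "int q" p1 p2] that ij c one[of i "real q"] one[of j "real q"] by (auto simp: less_max_iff_disj)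
  with c(1) show ?thesis using ij unfolding Bad_def by auto
qed

lemma BA_member:
  assumes \<epsilon>: "0 < \<epsilon>"
    and far: "\<And>r q :: int. 0 < q \<Longrightarrow> \<epsilon> * of_int q powr - 1 \<le> \<bar>of_int q * y - of_int r\<bar>"
  shows "y \<in> BA"
proof -
  have "\<epsilon> / 2 < real q * \<bar>real q * y - of_int p\<bar>" if "1 \<le> q" for p :: int and q :: nat
  proof -
    have "\<epsilon> / real q \<le> \<bar>real q * y - of_int p\<bar>"
      using far[of "int q" p] that by (simp add: powr_minus divide_inverse)
    then have "\<epsilon> \<le> real q * \<bar>real q * y - of_int p\<bar>" using that by (simp add: field_simps)
    with \<epsilon> show ?thesis by linarith
  qed
  then show ?thesis using \<epsilon> unfolding BA_def by (intro CollectI exI[of _ "\<epsilon> / 2"]) auto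
qed

lemma Bad1_mono:
  assumes "0 < i" "i \<le> i'" "\<theta> \<in> Bad1 i'"
  shows "\<theta> \<in> Bad1 i"
proof -
  obtain c where c: "c > 0" "\<And>(p::int) (q::nat). q \<ge> 1 \<Longrightarrow> real q powr (1 / i') * \<bar>real q * \<theta> - of_int p\<bar> > c"
    using assms unfolding Bad1_def by (auto split: if_splits)
  have "c < real q powr (1 / i) * \<bar>real q * \<theta> - of_int p\<bar>" if "1 \<le> q" for p :: int and q :: nat
  proof -
    have "c < real q powr (1 / i') * \<bar>real q * \<theta> - of_int p\<bar>" using that by (rule c)
    also have "\<dots> \<le> real q powr (1 / i) * \<bar>real q * \<theta> - of_int p\<bar>"
      using that assms by (intro mult_right_mono powr_mono frac_le) auto
    finally show ?thesis .
  qed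
  then show ?thesis using c(1) assms(1) unfolding Bad1_def by auto
qed

text \<open>
The two degenerate weights fit in as well. For \<open>j = 0\<close> the condition concerns \<open>\<theta>\<close> alone
and there is nothing to avoid. For \<open>i = 0\<close> it concerns \<open>y\<close> alone.
\<close>

lemma Bad_fibre_obstacle_family:
  assumes ij: "0 \<le> i" "0 \<le> j" "i + j = 1" and \<theta>: "i = 0 \<or> \<theta> \<in> Bad1 i" and R: "8 \<le> R"
  obtains \<kappa>0 where "0 < \<kappa>0" "\<And>\<kappa>. 0 < \<kappa> \<Longrightarrow> \<kappa> < \<kappa>0 \<Longrightarrow> \<exists>D. obstacle_family R \<kappa> {y. (\<theta>, y) \<in> Bad i j} D"
proof (cases "j = 0")
  case True
  then have "\<theta> \<in> BA" using \<theta> ij by (simp add: Bad1_def BA_def)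
  then have "obstacle_family R \<kappa> {y. (\<theta>, y) \<in> Bad i j} (\<lambda>n c. {})" for \<kappa>
    using True by (simp add: obstacle_family_def Bad_def)
  then show ?thesis by (intro that[of 1]) auto
next
  case False
  then have j: "0 < j" using ij by simp
  define K where "K = R powr ((5 + 1 / j) / j + 3)"
  have K: "0 < K" using R by (simp add: K_def)
  show ?thesis
  proof (cases "i = 0")
    case True
    \<comment> \<open>Since \<open>y\<close> alone matters, \<open>\<theta>\<close> may be replaced by \<open>0\<close>. The rational points then have
      abscissa \<open>0\<close>, and the line through them is \<open>q y = r\<close>.\<close>
    define \<kappa>0 where "\<kappa>0 = min 1 (1 / (3 * K))"
    show ?thesis
    proof (rule that)
      show "0 < \<kappa>0" using K by (simp add: \<kappa>0_def)
      fix \<kappa> :: real assume \<kappa>: "0 < \<kappa>" "\<kappa> < \<kappa>0"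
      have "j = 1" using True ij by simp
      have "\<kappa> < 1 / (3 * K)" using \<kappa> by (simp add: \<kappa>0_def)
      then have \<kappa>K: "3 * \<kappa> * K < 1" using K by (simp add: field_simps)
      interpret weighted_line_system i j 0 "\<kappa> / 4" R
      proof
        show "12 * (\<kappa> / 4) * R powr ((5 + 1 / j) / j + 3) < 1" using \<kappa>K by (simp add: K_def)
        fix p r q :: int assume q: "0 < q" "\<bar>of_int q * 0 - of_int p\<bar> < \<kappa> / 4 * of_int q powr - i"
        have "\<bar>real_of_int p\<bar> < 1" using q \<kappa> True by (simp add: \<kappa>0_def)
        then have "p = 0" by (rule int_abs_less_one)
        with q show "\<exists>A B C :: int. 0 < B \<and> A * p + B * r + C * q = 0 \<and>
          \<bar>of_int A\<bar> \<le> real_of_int q powr i \<and> of_int B \<le> real_of_int q powr j"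
          using \<open>j = 1\<close> by (intro exI[of _ 0] exI[of _ q] exI[of _ "- r"]) auto
      qed (use ij j R \<kappa> in auto)
      have "y \<in> {y. (\<theta>, y) \<in> Bad i j}"
        if "\<And>p r q :: int. 0 < q \<Longrightarrow> \<kappa> / 4 * of_int q powr - i \<le> \<bar>of_int q * 0 - of_int p\<bar> \<or>
             \<kappa> / 4 * of_int q powr - j \<le> \<bar>of_int q * y - of_int r\<bar>" for y
      proof -
        have "y \<in> BA"
        proof (rule BA_member[of "\<kappa> / 4"])
          fix r q :: int assume "0 < q"
          with that[of q 0 r] show "\<kappa> / 4 * of_int q powr - 1 \<le> \<bar>of_int q * y - of_int r\<bar>"
            using \<kappa> True \<open>j = 1\<close> by auto
        qed (use \<kappa> in simp)
        then show ?thesis using True \<open>j = 1\<close> by (simp add: Bad_def)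
      qed
      from obstacle_family_obstacle[OF this]
      have "obstacle_family R \<kappa> {y. (\<theta>, y) \<in> Bad i j} obstacle" by simp
      then show "\<exists>D. obstacle_family R \<kappa> {y. (\<theta>, y) \<in> Bad i j} D" by (rule exI[of _ obstacle])
    qed
  next
    case False
    then have i: "0 < i" and "\<theta> \<in> Bad1 i" using ij \<theta> by auto
    then obtain c where c: "c > 0"
      "\<And>(p::int) (q::nat). q \<ge> 1 \<Longrightarrow> real q powr (1 / i) * \<bar>real q * \<theta> - of_int p\<bar> > c"
      unfolding Bad1_def by auto
    define \<kappa>0 where "\<kappa>0 = min c (1 / (3 * K))"
    show ?thesis
    proof (rule that)
      show "0 < \<kappa>0" using K c by (simp add: \<kappa>0_def)
      fix \<kappa> :: real assume \<kappa>: "0 < \<kappa>" "\<kappa> < \<kappa>0"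
      have "\<kappa> < 1 / (3 * K)" using \<kappa> by (simp add: \<kappa>0_def)
      then have \<kappa>K: "3 * \<kappa> * K < 1" using K by (simp add: field_simps)
      interpret weighted_line_system i j \<theta> "\<kappa> / 4" R
      proof
        show "12 * (\<kappa> / 4) * R powr ((5 + 1 / j) / j + 3) < 1" using \<kappa>K by (simp add: K_def)
        fix p r q :: int assume q: "0 < q" "\<bar>of_int q * \<theta> - of_int p\<bar> < \<kappa> / 4 * of_int q powr - i"
        have "\<kappa> / 4 \<le> c" using \<kappa> by (simp add: \<kappa>0_def)
        then show "\<exists>A B C :: int. 0 < B \<and> A * p + B * r + C * q = 0 \<and>
          \<bar>of_int A\<bar> \<le> real_of_int q powr i \<and> of_int B \<le> real_of_int q powr j"
          using i ij c q \<kappa> by (intro bad_abscissa_non_vertical_line[of i j c \<theta> "\<kappa> / 4"]) auto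
      qed (use ij j R \<kappa> in auto)
      have "y \<in> {y. (\<theta>, y) \<in> Bad i j}"
        if "\<And>p r q :: int. 0 < q \<Longrightarrow> \<kappa> / 4 * of_int q powr - i \<le> \<bar>of_int q * \<theta> - of_int p\<bar> \<or>
             \<kappa> / 4 * of_int q powr - j \<le> \<bar>of_int q * y - of_int r\<bar>" for y
        using Bad_member[OF \<open>0 < i\<close> \<open>0 < j\<close> _ that] \<kappa> by simp
      from obstacle_family_obstacle[OF this]
      have "obstacle_family R \<kappa> {y. (\<theta>, y) \<in> Bad i j} obstacle" by simp
      then show "\<exists>D. obstacle_family R \<kappa> {y. (\<theta>, y) \<in> Bad i j} D" by (rule exI[of _ obstacle])
    qed
  qed
qed

theorem theorem7:
  fixes i j :: "nat \<Rightarrow> real"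
    and \<theta> :: real
    and M :: "(real \<times> real) measure"
    and C :: "(real \<times> real) set"
  assumes "\<And>t. i t \<in> {0..1}"
    and "\<And>t. j t \<in> {0..1}"
    and "\<And>t. i t + j t = 1"
    and "\<theta> \<in> Bad1 (SUP t. i t)"
    and "sets M = sets borel"
    and "emeasure M (space M) \<noteq> 0"
    and "power_law M"
    and "C = measure_support M"
    and "C \<subseteq> {(\<theta>, y) | y. y \<in> {0..1}}"
  shows "C \<inter> (\<Inter>t. Bad (i t) (j t)) \<noteq> {}"
proof -
  have C: "compact C" "C \<noteq> {}"
  proof -
    have "closed C" using assms(8) closed_measure_support by simp
    moreover have "C \<subseteq> {\<theta>} \<times> {0..1}" using assms(9) by auto
    then have "bounded C" by (rule bounded_subset[rotated]) (intro bounded_Times; simp)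
    ultimately show "compact C" by (simp add: compact_eq_bounded_closed)
    have "space M = UNIV" using sets_eq_imp_space_eq[OF assms(5)] by simp
    then show "C \<noteq> {}"
      using null_set_outside_measure_support[OF assms(5)] assms(6,8) by (auto simp: null_sets_def)
  qed
  obtain r where r: "0 < r" "r \<le> 1/8" and branching:
    "\<And>m x. x \<in> C \<Longrightarrow> \<exists>F. F \<subseteq> C \<and> finite F \<and> card F = 4 \<and>
       (\<forall>f\<in>F. ball f (r ^ Suc m) \<subseteq> ball x (r ^ m)) \<and> pairwise (\<lambda>y z. 3 * r ^ Suc m \<le> dist y z) F"
    using power_law_branching[OF assms(5,7)] unfolding assms(8)[symmetric] by metis
  define R where "R t = (1 / r) ^ (t + 5)" for t
  have R: "8 \<le> R t" for t
  proof -
    have "8 \<le> 1 / r" using r by (simp add: field_simps)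
    also have "\<dots> = (1 / r) ^ 1" by simp
    also have "\<dots> \<le> R t" unfolding R_def using r by (intro power_increasing) auto
    finally show ?thesis .
  qed
  have bdd: "bdd_above (range i)" using assms(1) by (intro bdd_aboveI[of _ 1]) auto
  have "\<exists>a D. t + 5 \<le> a \<and> obstacle_family (R t) (r ^ a) {y. (\<theta>, y) \<in> Bad (i t) (j t)} D" for t
  proof -
    have "i t \<le> (SUP t. i t)" using bdd by (intro cSUP_upper) auto
    then have "i t = 0 \<or> \<theta> \<in> Bad1 (i t)"
      using Bad1_mono[of "i t" _ \<theta>] assms(1)[of t] assms(4) by fastforce
    then obtain \<kappa>0 where \<kappa>0: "0 < \<kappa>0"
      "\<And>\<kappa>. 0 < \<kappa> \<Longrightarrow> \<kappa> < \<kappa>0 \<Longrightarrow> \<exists>D. obstacle_family (R t) \<kappa> {y. (\<theta>, y) \<in> Bad (i t) (j t)} D"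
      using Bad_fibre_obstacle_family[of "i t" "j t" \<theta> "R t"] assms(1-3)[of t] R by auto
    \<comment> \<open>The starting scale \<open>r ^ a\<close> plays the role of \<open>\<kappa>\<close>. It depends on \<open>t\<close> without harm.\<close>
    obtain b where "r ^ b < \<kappa>0" using real_arch_pow_inv[OF \<kappa>0(1), of r] r by auto
    moreover have "r ^ (b + (t + 5)) \<le> r ^ b" using r by (intro power_decreasing) auto
    ultimately have "r ^ (b + (t + 5)) < \<kappa>0" by linarith
    then have "\<exists>D. obstacle_family (R t) (r ^ (b + (t + 5))) {y. (\<theta>, y) \<in> Bad (i t) (j t)} D"
      using r by (intro \<kappa>0(2)) auto
    then show ?thesis by (intro exI[of _ "b + (t + 5)"]) auto
  qed
  then obtain a D where a: "\<And>t. t + 5 \<le> a t"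
    and D: "\<And>t. obstacle_family (R t) (r ^ a t) {y. (\<theta>, y) \<in> Bad (i t) (j t)} (D t)"
    by metis
  have dist_C: "dist x y = \<bar>snd x - snd y\<bar>" if "x \<in> C" "y \<in> C" for x y
  proof -
    have "fst x = fst y" using subsetD[OF assms(9) that(1)] subsetD[OF assms(9) that(2)] by auto
    then show ?thesis by (simp add: dist_prod_def dist_real_def)
  qed
  have "\<exists>x\<in>C. \<forall>t n c. x \<notin> snd -` D t n c"
  proof (rule avoid_obstacle_families[OF r(1) _ C branching _ _ a])
    fix t n c
    show "open (snd -` D t n c :: (real \<times> real) set)"
      using D[of t] unfolding obstacle_family_def by (intro open_vimage_snd) auto
  next
    fix t n c :: nat assume "n < c"
    then show "(snd -` D t n c :: (real \<times> real) set) = {}"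
      using D[of t] unfolding obstacle_family_def by auto
  next
    fix t n c and y z :: "real \<times> real"
    assume cn: "c \<le> n" and yz: "y \<in> C \<inter> snd -` D t n c" "z \<in> C \<inter> snd -` D t n c"
      and d: "dist y z < 2 * r ^ (a t + (t + 5) * n - (t + 5) * (c + 1))"
    have le: "(t + 5) * (c + 1) \<le> a t + (t + 5) * n"
    proof -
      have "(t + 5) * c \<le> (t + 5) * n" using cn by (intro mult_left_mono) auto
      moreover have "(t + 5) * (c + 1) = (t + 5) * c + (t + 5)" by simp
      ultimately show ?thesis using a[of t] by linarith
    qed
    have powR: "R t ^ k = 1 / r ^ ((t + 5) * k)" for k
      by (simp add: R_def power_mult[symmetric] power_one_over)
    have e: "r ^ (a t + (t + 5) * n) = r ^ a t / R t ^ n" by (simp add: powR power_add)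
    have "r ^ (a t + (t + 5) * n - (t + 5) * (c + 1)) = r ^ (a t + (t + 5) * n) / r ^ ((t + 5) * (c + 1))"
      using r le by (intro power_diff) auto
    also have "\<dots> = r ^ a t * R t ^ Suc c / R t ^ n"
      unfolding e powR by simp
    finally have s: "r ^ (a t + (t + 5) * n - (t + 5) * (c + 1)) = r ^ a t * R t ^ Suc c / R t ^ n" .
    have "\<bar>snd y - snd z\<bar> \<le> 2 * r ^ a t * R t ^ Suc c / R t ^ n"
      using d yz unfolding s by (simp add: dist_C del: power_Suc)
    then have "\<bar>snd y - snd z\<bar> \<le> r ^ a t / R t ^ n \<or> (\<exists>n' c'. n' + c + 1 \<le> n \<and> snd y \<in> D t n' c')"
      using D[of t] yz unfolding obstacle_family_def by blast
    then show "dist y z \<le> r ^ (a t + (t + 5) * n) \<or> (\<exists>n' c'. n' + c + 1 \<le> n \<and> y \<in> snd -` D t n' c')"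
      using yz unfolding e by (simp add: dist_C)
  qed (use r in auto)
  then obtain x where x: "x \<in> C" "\<And>t n c. snd x \<notin> D t n c" by auto
  have "x = (\<theta>, snd x)" using subsetD[OF assms(9) x(1)] by auto
  moreover have "(\<theta>, snd x) \<in> Bad (i t) (j t)" for t
    using obstacle_family_covers[OF D x(2)] by simp
  ultimately have "x \<in> Bad (i t) (j t)" for t by simp
  with x(1) show ?thesis by blast
qed

end
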